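(* Let $K$ be a field, $R$ a $K$-algebra, and $E=(E^0,E^1,\mathbf{s},\mathbf{r})$ a graph. Then there is a one-to-one correspondence between the $K$-linear traces $t: L_K(E) \to R$ and the maps $\delta : G_E \to R$ that preserve zero and satisfy the following conditions. (1) If $\delta (x) \neq 0$ for some $x \in G_E$, then either $x=pqp^*$ or $x=pq^*p^*$ for some $p \in \mathrm{Path}(E)$ and $q \in \mathrm{ClPath}(E)$. (2) For all $p \in \mathrm{Path}(E)$ and $q \in \mathrm{ClPath}(E)$ with $\mathbf{r}(p)=\mathbf{s}(q)$, we have $\delta(pqp^* )=\delta(q)$ and $\delta(pq^*p^* )=\delta(q^* )$. (3) For all $p,q \in \mathrm{ClPath}(E)$ such that $p \approx q$, we have $\delta (p) = \delta (q)$ and $\delta (p^* ) = \delta (q^* )$. (4) For all regular $v \in E^0$ we have $\delta (v) = \sum _{e\in \mathbf{s}^{-1}(v)} \delta (\mathbf{r}(e))$. The one-to-one correspondence maps $K$-linear traces on $L_K(E)$ to their restrictions to $G_E$.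
   Context: Rings and algebras are associative but not necessarily unital. A graph $E=(E^0,E^1,\mathbf{s},\mathbf{r})$ consists of sets $E^0$ (vertices) and $E^1$ (edges) and maps $\mathbf{s},\mathbf{r}:E^1\to E^0$ (source and range). A path is a finite sequence $p=e_1\cdots e_n$ of edges with $\mathbf{r}(e_i)=\mathbf{s}(e_{i+1})$ for $1\le i<n$; $\mathbf{s}(p)=\mathbf{s}(e_1)$, $\mathbf{r}(p)=\mathbf{r}(e_n)$. Vertices $v$ are regarded as paths of length $0$ with $\mathbf{s}(v)=\mathbf{r}(v)=v$. $\mathrm{Path}(E)$ is the set of all paths, and $\mathrm{ClPath}(E)$ the set of closed paths, i.e., those $p \in \mathrm{Path}(E)$ with $\mathbf{s}(p)=\mathbf{r}(p)$ (including vertices). A vertex $v$ is regular if $\mathbf{s}^{-1}(v)=\{e\in E^1\mid \mathbf{s}(e)=v\}$ is finite and nonempty. For $p,q\in\mathrm{ClPath}(E)$, $p\approx q$ means that there are $x,y\in\mathrm{Path}(E)$ with $p=xy$ and $yx=q$. The graph inverse semigroup $G_E$ is the semigroup with zero generated by $E^0$, $E^1$ and symbols $\{e^*\mid e\in E^1\}$, subject to, for all $v,w\in E^0$, $e,f\in E^1$: $vw=\delta_{v,w}v$; $\mathbf{s}(e)e=e\mathbf{r}(e)=e$; $\mathbf{r}(e)e^*=e^*\mathbf{s}(e)=e^*$; $e^*f=\delta_{e,f}\mathbf{r}(e)$ (here $\delta_{\cdot,\cdot}$ is the Kronecker delta). Set $v^*:=v$ for $v\in E^0$ and $(e_1\cdots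 e_n)^*:=e_n^*\cdots e_1^*$. Every nonzero element of $G_E$ is uniquely $pq^*$ with $p,q\in\mathrm{Path}(E)$, $\mathbf{r}(p)=\mathbf{r}(q)$. $C_K(E)=\overline{KG_E}$ is the contracted semigroup ring (the semigroup ring $KG_E$ with the zero of $G_E$ identified with the zero of the ring). The Leavitt path algebra is $L_K(E)=C_K(E)/N$, where $N$ is the ideal generated by all $v-\sum_{e\in\mathbf{s}^{-1}(v)}ee^*$ with $v\in E^0$ regular. The restriction of $t:L_K(E)\to R$ to $G_E$ is the map $g\mapsto t(g+N)$. A map $\delta:G_E\to R$ preserves zero if $\delta(0)=0$. A $K$-linear trace $t:L_K(E)\to R$ is a $K$-linear map with $t(xy)=t(yx)$ for all $x,y\in L_K(E)$. *)

theory Defs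
  imports
    "Graph_Theory.Arc_Walk"
    "HOL-Library.Poly_Mapping"
    "HOL-Library.FuncSet"
begin

section \<open>Paths\<close>

text \<open>
  A path is a pair of a start vertex and a list of arcs. The start vertex is redundant unless the
  list is empty, and \<^term>\<open>(v, [])\<close> is the vertex \<^term>\<open>v\<close> regarded as a path of length 0.
\<close>

type_synonym ('v, 'e) path = "'v \<times> 'e list"

definition psrc :: "('v, 'e) path \<Rightarrow> 'v" where
  "psrc p = fst p"

definition pran :: "('v, 'e) pre_digraph \<Rightarrow> ('v, 'e) path \<Rightarrow> 'v" where
  "pran E p = pre_digraph.awlast E (fst p) (snd p)"

definition Path :: "('v, 'e) pre_digraph \<Rightarrow> ('v, 'e) path set" where
  "Path E = {(v, es). \<exists>w. pre_digraph.awalk E v es w}"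

definition ClPath :: "('v, 'e) pre_digraph \<Rightarrow> ('v, 'e) path set" where
  "ClPath E = {p \<in> Path E. psrc p = pran E p}"

text \<open>Only meaningful if the range of the first path is the source of the second.\<close>

definition pconc :: "('v, 'e) path \<Rightarrow> ('v, 'e) path \<Rightarrow> ('v, 'e) path" where
  "pconc p q = (fst p, snd p @ snd q)"

definition path_approx :: "('v, 'e) pre_digraph \<Rightarrow> ('v, 'e) path \<Rightarrow> ('v, 'e) path \<Rightarrow> bool" where
  "path_approx E p q \<longleftrightarrow>
     (\<exists>x\<in>Path E. \<exists>y\<in>Path E. pran E x = psrc y \<and> pran E y = psrc x \<and>
        p = pconc x y \<and> pconc y x = q)"

definition regular_vertex :: "('v, 'e) pre_digraph \<Rightarrow> 'v \<Rightarrow> bool" where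
  "regular_vertex E v \<longleftrightarrow> v \<in> verts E \<and> finite (out_arcs E v) \<and> out_arcs E v \<noteq> {}"


section \<open>The graph inverse semigroup\<close>

datatype ('v, 'e) gen = Vertex 'v | Edge 'e | Ghost 'e

definition gens :: "('v, 'e) pre_digraph \<Rightarrow> ('v, 'e) gen set" where
  "gens E = Vertex ` verts E \<union> Edge ` arcs E \<union> Ghost ` arcs E"

text \<open>
  The free semigroup with zero on the generators: nonempty words, together with the zero
  \<^term>\<open>None\<close>.
\<close>

type_synonym ('v, 'e) word0 = "('v, 'e) gen list option"

definition words0 :: "('v, 'e) pre_digraph \<Rightarrow> ('v, 'e) word0 set" where
  "words0 E = insert None (Some ` (lists (gens E) - {[]}))"

fun cat0 :: "('v, 'e) word0 \<Rightarrow> ('v, 'e) word0 \<Rightarrow> ('v, 'e) word0" where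
  "cat0 (Some a) (Some b) = Some (a @ b)"
| "cat0 _ _ = None"

inductive_set gis_cong :: "('v, 'e) pre_digraph \<Rightarrow> ('v, 'e) word0 rel"
  for E :: "('v, 'e) pre_digraph"
where
  refl: "a \<in> words0 E \<Longrightarrow> (a, a) \<in> gis_cong E"
| sym: "(a, b) \<in> gis_cong E \<Longrightarrow> (b, a) \<in> gis_cong E"
| trans: "(a, b) \<in> gis_cong E \<Longrightarrow> (b, c) \<in> gis_cong E \<Longrightarrow> (a, c) \<in> gis_cong E"
| cat_left: "(a, b) \<in> gis_cong E \<Longrightarrow> c \<in> words0 E \<Longrightarrow> (cat0 c a, cat0 c b) \<in> gis_cong E"
| cat_right: "(a, b) \<in> gis_cong E \<Longrightarrow> c \<in> words0 E \<Longrightarrow> (cat0 a c, cat0 b c) \<in> gis_cong E"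
| vertex_vertex: "v \<in> verts E \<Longrightarrow> w \<in> verts E \<Longrightarrow>
    (Some [Vertex v, Vertex w], if v = w then Some [Vertex v] else None) \<in> gis_cong E"
| source_edge: "e \<in> arcs E \<Longrightarrow> (Some [Vertex (tail E e), Edge e], Some [Edge e]) \<in> gis_cong E"
| edge_range: "e \<in> arcs E \<Longrightarrow> (Some [Edge e, Vertex (head E e)], Some [Edge e]) \<in> gis_cong E"
| range_ghost: "e \<in> arcs E \<Longrightarrow> (Some [Vertex (head E e), Ghost e], Some [Ghost e]) \<in> gis_cong E"
| ghost_source: "e \<in> arcs E \<Longrightarrow> (Some [Ghost e, Vertex (tail E e)], Some [Ghost e]) \<in> gis_cong E"
| ghost_edge: "e \<in> arcs E \<Longrightarrow> f \<in> arcs E \<Longrightarrow>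
    (Some [Ghost e, Edge f], if e = f then Some [Vertex (head E e)] else None) \<in> gis_cong E"

type_synonym ('v, 'e) gis = "('v, 'e) word0 set"

definition gis_cls :: "('v, 'e) pre_digraph \<Rightarrow> ('v, 'e) word0 \<Rightarrow> ('v, 'e) gis" where
  "gis_cls E a = gis_cong E `` {a}"

definition gis :: "('v, 'e) pre_digraph \<Rightarrow> ('v, 'e) gis set" where
  "gis E = words0 E // gis_cong E"

definition gis_zero :: "('v, 'e) pre_digraph \<Rightarrow> ('v, 'e) gis" where
  "gis_zero E = gis_cls E None"

definition gis_mult :: "('v, 'e) pre_digraph \<Rightarrow> ('v, 'e) gis \<Rightarrow> ('v, 'e) gis \<Rightarrow> ('v, 'e) gis" where
  "gis_mult E X Y = (\<Union>a\<in>X. \<Union>b\<in>Y. gis_cls E (cat0 a b))"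

definition gvert :: "('v, 'e) pre_digraph \<Rightarrow> 'v \<Rightarrow> ('v, 'e) gis" where
  "gvert E v = gis_cls E (Some [Vertex v])"

definition gpath :: "('v, 'e) pre_digraph \<Rightarrow> ('v, 'e) path \<Rightarrow> ('v, 'e) gis" where
  "gpath E p = (if snd p = [] then gvert E (fst p) else gis_cls E (Some (map Edge (snd p))))"

definition gstar :: "('v, 'e) pre_digraph \<Rightarrow> ('v, 'e) path \<Rightarrow> ('v, 'e) gis" where
  "gstar E p = (if snd p = [] then gvert E (fst p) else gis_cls E (Some (rev (map Ghost (snd p)))))"


section \<open>Algebras over a field, not necessarily unital\<close>

locale k_algebra = vector_space scale
  for scale :: "'k::field \<Rightarrow> 'r::ring \<Rightarrow> 'r" +
  assumes scale_mult_left: "scale c x * y = scale c (x * y)"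
    and scale_mult_right: "x * scale c y = scale c (x * y)"

text \<open>
  Leavitt path algebras depend on a graph, hence are given by explicit carriers. The ring and module
  records of HOL-Algebra are not used because they presuppose a multiplicative identity.
\<close>

record ('k, 'a) kalg =
  acarrier :: "'a set"
  azero :: 'a
  aadd :: "'a \<Rightarrow> 'a \<Rightarrow> 'a"
  amult :: "'a \<Rightarrow> 'a \<Rightarrow> 'a"
  ascale :: "'k \<Rightarrow> 'a \<Rightarrow> 'a"

definition alg_ideal :: "('k, 'a) kalg \<Rightarrow> 'a set \<Rightarrow> bool" where
  "alg_ideal A I \<longleftrightarrow>
     I \<subseteq> acarrier A \<and> azero A \<in> I \<and>
     (\<forall>x\<in>I. \<forall>y\<in>I. aadd A x y \<in> I) \<and>
     (\<forall>c. \<forall>x\<in>I. ascale A c x \<in> I) \<and>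
     (\<forall>a\<in>acarrier A. \<forall>x\<in>I. amult A a x \<in> I \<and> amult A x a \<in> I)"

definition gen_ideal :: "('k, 'a) kalg \<Rightarrow> 'a set \<Rightarrow> 'a set" where
  "gen_ideal A X = \<Inter> {I. alg_ideal A I \<and> X \<subseteq> I}"

definition alg_coset :: "('k, 'a) kalg \<Rightarrow> 'a set \<Rightarrow> 'a \<Rightarrow> 'a set" where
  "alg_coset A I x = aadd A x ` I"

definition alg_quot :: "('k, 'a) kalg \<Rightarrow> 'a set \<Rightarrow> ('k, 'a set) kalg" where
  "alg_quot A I = \<lparr>
     acarrier = alg_coset A I ` acarrier A,
     azero = alg_coset A I (azero A),
     aadd = (\<lambda>X Y. \<Union>x\<in>X. \<Union>y\<in>Y. alg_coset A I (aadd A x y)),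
     amult = (\<lambda>X Y. \<Union>x\<in>X. \<Union>y\<in>Y. alg_coset A I (amult A x y)),
     ascale = (\<lambda>c X. \<Union>x\<in>X. alg_coset A I (ascale A c x)) \<rparr>"

text \<open>The trace is undefined outside the carrier, so that it is determined by its values there.\<close>

definition linear_trace ::
  "('k \<Rightarrow> 'r \<Rightarrow> 'r) \<Rightarrow> ('k, 'a) kalg \<Rightarrow> ('a \<Rightarrow> 'r::plus) \<Rightarrow> bool" where
  "linear_trace scale A t \<longleftrightarrow>
     t \<in> extensional (acarrier A) \<and>
     (\<forall>x\<in>acarrier A. \<forall>y\<in>acarrier A. t (aadd A x y) = t x + t y) \<and>
     (\<forall>c. \<forall>x\<in>acarrier A. t (ascale A c x) = scale c (t x)) \<and>
     (\<forall>x\<in>acarrier A. \<forall>y\<in>acarrier A. t (amult A x y) = t (amult A y x))"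


section \<open>Semigroup rings and Leavitt path algebras\<close>

definition semigroup_alg ::
  "'g set \<Rightarrow> ('g \<Rightarrow> 'g \<Rightarrow> 'g) \<Rightarrow> ('k::field, 'g \<Rightarrow>\<^sub>0 'k) kalg" where
  "semigroup_alg S m = \<lparr>
     acarrier = {f. Poly_Mapping.keys f \<subseteq> S},
     azero = 0,
     aadd = (+),
     amult = (\<lambda>f h. \<Sum>a\<in>Poly_Mapping.keys f. \<Sum>b\<in>Poly_Mapping.keys h.
        Poly_Mapping.single (m a b) (Poly_Mapping.lookup f a * Poly_Mapping.lookup h b)),
     ascale = (\<lambda>c. Poly_Mapping.map ((*) c)) \<rparr>"

definition gis_alg :: "('v, 'e) pre_digraph \<Rightarrow> ('k::field, ('v, 'e) gis \<Rightarrow>\<^sub>0 'k) kalg" where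
  "gis_alg E = semigroup_alg (gis E) (gis_mult E)"

text \<open>Identifying the two zeros amounts to factoring out the ideal generated by the basis element 0.\<close>

definition zero_ideal :: "('v, 'e) pre_digraph \<Rightarrow> (('v, 'e) gis \<Rightarrow>\<^sub>0 'k::field) set" where
  "zero_ideal E = gen_ideal (gis_alg E) {Poly_Mapping.single (gis_zero E) 1}"

definition contracted_alg ::
  "('v, 'e) pre_digraph \<Rightarrow> ('k::field, (('v, 'e) gis \<Rightarrow>\<^sub>0 'k) set) kalg" where
  "contracted_alg E = alg_quot (gis_alg E) (zero_ideal E)"

definition leavitt_ideal ::
  "('v, 'e) pre_digraph \<Rightarrow> (('v, 'e) gis \<Rightarrow>\<^sub>0 'k::field) set set" where
  "leavitt_ideal E = gen_ideal (contracted_alg E)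
     {alg_coset (gis_alg E) (zero_ideal E)
        (Poly_Mapping.single (gvert E v) 1 -
         (\<Sum>e\<in>out_arcs E v. Poly_Mapping.single
            (gis_mult E (gis_cls E (Some [Edge e])) (gis_cls E (Some [Ghost e]))) 1))
      | v. regular_vertex E v}"

definition leavitt_alg ::
  "('v, 'e) pre_digraph \<Rightarrow> ('k::field, (('v, 'e) gis \<Rightarrow>\<^sub>0 'k) set set) kalg" where
  "leavitt_alg E = alg_quot (contracted_alg E) (leavitt_ideal E)"

definition leavitt_of_gis ::
  "('v, 'e) pre_digraph \<Rightarrow> ('v, 'e) gis \<Rightarrow> (('v, 'e) gis \<Rightarrow>\<^sub>0 'k::field) set set" where
  "leavitt_of_gis E g = alg_coset (contracted_alg E) (leavitt_ideal E)
     (alg_coset (gis_alg E) (zero_ideal E) (Poly_Mapping.single g 1))"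

definition restrict_to_gis ::
  "('v, 'e) pre_digraph \<Rightarrow> ((('v, 'e) gis \<Rightarrow>\<^sub>0 'k::field) set set \<Rightarrow> 'r) \<Rightarrow> ('v, 'e) gis \<Rightarrow> 'r" where
  "restrict_to_gis E t = (\<lambda>g\<in>gis E. t (leavitt_of_gis E g))"

end

theory Submission
  imports Defs
begin

text \<open>
  The algebra is spanned by the images of the semigroup elements, and two general facts about
  traces reduce the statement to the semigroup. Traces on a semigroup algebra are the functions
  \<open>\<delta>\<close> on the semigroup with \<open>\<delta> (x y) = \<delta> (y x)\<close>. Traces on a quotient by the ideal generated
  by \<open>X\<close> are the traces \<open>T\<close> with \<open>T x = 0\<close> and \<open>T (a x) = 0\<close> for all \<open>x\<close> in \<open>X\<close> and all \<open>a\<close>.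

  Conditions (1)--(3) say exactly that \<open>\<delta> (x y) = \<delta> (y x)\<close>: if \<open>\<delta> (p q\<^sup>*) = \<delta> (q\<^sup>* p)\<close> is nonzero, then
  \<open>q\<^sup>* p\<close> is nonzero and one of \<open>p\<close>, \<open>q\<close> is a prefix of the other. Conversely it suffices to let
  \<open>y\<close> be a generator, and the involution reduces ghost arcs to arcs. The uniqueness of normal forms
  \<open>p q\<^sup>*\<close> is read off from the action of the semigroup on paths. Finally, by the trace property
  \<open>\<delta> (g e e\<^sup>*) = \<delta> (e\<^sup>* g e)\<close>, all relations imposed by a regular vertex follow from condition (4).
\<close>

section \<open>Quotients of algebras\<close>

text \<open>The Leavitt algebra arises in stages: the semigroup algebra, its quotient by the basis
  element of the semigroup zero, and the quotient of that by the vertex relations. The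
  correspondence is therefore a composite of three bijections, each of which evaluates a trace on
  representatives or on basis elements and keeps track of the constraints on its image. Their
  composite is \<open>restrict_to_gis\<close> itself, so surjectivity of the restriction comes with
  it. The algebras may lack a unit, which is why vanishing on an ideal is tested by
  \<open>T x = 0\<close> and by \<open>T (a x) = 0\<close>. The semigroup is given by generators and
  relations, and these yield equalities only. Inequalities, such as that a normal form is nonzero,
  require an invariant of words; this is why an action has to be constructed.\<close>

locale kalg_laws =
  fixes A :: "('k::field, 'a) kalg"
  assumes zero_closed: "azero A \<in> acarrier A"
    and add_closed: "x \<in> acarrier A \<Longrightarrow> y \<in> acarrier A \<Longrightarrow> aadd A x y \<in> acarrier A"
    and mult_closed: "x \<in> acarrier A \<Longrightarrow> y \<in> acarrier A \<Longrightarrow> amult A x y \<in> acarrier A"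
    and scale_closed: "x \<in> acarrier A \<Longrightarrow> ascale A c x \<in> acarrier A"
    and add_assoc: "x \<in> acarrier A \<Longrightarrow> y \<in> acarrier A \<Longrightarrow> z \<in> acarrier A \<Longrightarrow>
      aadd A (aadd A x y) z = aadd A x (aadd A y z)"
    and add_commute: "x \<in> acarrier A \<Longrightarrow> y \<in> acarrier A \<Longrightarrow> aadd A x y = aadd A y x"
    and add_zero: "x \<in> acarrier A \<Longrightarrow> aadd A x (azero A) = x"
    and add_neg: "x \<in> acarrier A \<Longrightarrow> aadd A x (ascale A (- 1) x) = azero A"
    and scale_add: "x \<in> acarrier A \<Longrightarrow> y \<in> acarrier A \<Longrightarrow>
      ascale A c (aadd A x y) = aadd A (ascale A c x) (ascale A c y)"
    and mult_assoc: "x \<in> acarrier A \<Longrightarrow> y \<in> acarrier A \<Longrightarrow> z \<in> acarrier A \<Longrightarrow>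
      amult A (amult A x y) z = amult A x (amult A y z)"
    and mult_add_right: "x \<in> acarrier A \<Longrightarrow> y \<in> acarrier A \<Longrightarrow> z \<in> acarrier A \<Longrightarrow>
      amult A x (aadd A y z) = aadd A (amult A x y) (amult A x z)"
    and mult_add_left: "x \<in> acarrier A \<Longrightarrow> y \<in> acarrier A \<Longrightarrow> z \<in> acarrier A \<Longrightarrow>
      amult A (aadd A y z) x = aadd A (amult A y x) (amult A z x)"
    and mult_scale_right: "x \<in> acarrier A \<Longrightarrow> y \<in> acarrier A \<Longrightarrow>
      amult A x (ascale A c y) = ascale A c (amult A x y)"
    and mult_scale_left: "x \<in> acarrier A \<Longrightarrow> y \<in> acarrier A \<Longrightarrow>
      amult A (ascale A c x) y = ascale A c (amult A x y)"

text \<open>An intersection over an empty family would be the whole type. The carrier, being an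
  ideal that contains \<open>X\<close>, is a member of the family and keeps the intersection inside
  the carrier.\<close>

lemma alg_ideal_gen_ideal:
  assumes "alg_ideal A (acarrier A)" "X \<subseteq> acarrier A"
  shows "alg_ideal A (gen_ideal A X)"
proof -
  have "gen_ideal A X \<subseteq> acarrier A"
    unfolding gen_ideal_def using assms by blast
  then show ?thesis
    unfolding alg_ideal_def by (auto simp: gen_ideal_def alg_ideal_def)
qed

lemma gen_ideal_least: "alg_ideal A I \<Longrightarrow> X \<subseteq> I \<Longrightarrow> gen_ideal A X \<subseteq> I"
  unfolding gen_ideal_def by blast

lemma gen_ideal_superset: "X \<subseteq> gen_ideal A X"
  unfolding gen_ideal_def by blast

context kalg_laws
begin

lemma alg_ideal_carrier: "alg_ideal A (acarrier A)"
  unfolding alg_ideal_def by (simp add: zero_closed add_closed mult_closed scale_closed)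

lemma alg_ideal_gen: "X \<subseteq> acarrier A \<Longrightarrow> alg_ideal A (gen_ideal A X)"
  by (rule alg_ideal_gen_ideal[OF alg_ideal_carrier])

context
  fixes I
  assumes I: "alg_ideal A I"
begin

lemma ideal_carrier: "i \<in> I \<Longrightarrow> i \<in> acarrier A"
  using I unfolding alg_ideal_def by blast

lemma mem_coset: "y \<in> alg_coset A I x \<longleftrightarrow> (\<exists>i\<in>I. y = aadd A x i)"
  unfolding alg_coset_def by blast

lemma coset_self: "x \<in> acarrier A \<Longrightarrow> x \<in> alg_coset A I x"
  using I unfolding mem_coset alg_ideal_def by (metis add_zero)

text \<open>Translation by \<open>i\<close> permutes the ideal. The record has no subtraction, so
  the inverse translation is by the multiple of \<open>i\<close> with -1.\<close>

lemma coset_absorb: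
  assumes x: "x \<in> acarrier A" and i: "i \<in> I"
  shows "alg_coset A I (aadd A x i) = alg_coset A I x"
proof -
  have ic: "i \<in> acarrier A" using ideal_carrier i .
  have n: "ascale A (-1) i \<in> I" using I i unfolding alg_ideal_def by blast
  have nc: "ascale A (-1) i \<in> acarrier A" using ideal_carrier n .
  have "y \<in> alg_coset A I (aadd A x i)" if "y \<in> alg_coset A I x" for y
  proof -
    obtain j where j: "j \<in> I" "y = aadd A x j"
      using \<open>y \<in> alg_coset A I x\<close> unfolding mem_coset by blast
    have jc: "j \<in> acarrier A" using ideal_carrier j(1) .
    have "aadd A (aadd A x i) (aadd A (ascale A (-1) i) j) =
        aadd A x (aadd A (aadd A i (ascale A (-1) i)) j)"
      using x ic nc jc by (simp add: add_assoc add_closed)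
    also have "\<dots> = y"
      by (simp add: j add_neg[OF ic] add_commute[OF zero_closed jc] add_zero[OF jc])
    finally have "y = aadd A (aadd A x i) (aadd A (ascale A (-1) i) j)" by simp
    moreover have "aadd A (ascale A (-1) i) j \<in> I" using I n j(1) unfolding alg_ideal_def by blast
    ultimately show ?thesis unfolding mem_coset by blast
  qed
  moreover have "y \<in> alg_coset A I x" if y: "y \<in> alg_coset A I (aadd A x i)" for y
  proof -
    obtain j where j: "j \<in> I" "y = aadd A (aadd A x i) j" using y unfolding mem_coset by blast
    have "y = aadd A x (aadd A i j)"
      using j x ic ideal_carrier by (simp add: add_assoc)
    moreover have "aadd A i j \<in> I" using I i j(1) unfolding alg_ideal_def by blast
    ultimately show ?thesis unfolding mem_coset by blast
  qed
  ultimately show ?thesis by blast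
qed

lemma quot_carrier: "acarrier (alg_quot A I) = alg_coset A I ` acarrier A"
  by (simp add: alg_quot_def)

lemma quot_zero: "azero (alg_quot A I) = alg_coset A I (azero A)"
  by (simp add: alg_quot_def)

text \<open>The quotient operations are unions over all choices of representatives. Every choice
  gives the same coset, and a choice exists because cosets are nonempty, so the union is that one
  coset.\<close>

lemma quot_add:
  assumes x: "x \<in> acarrier A" and y: "y \<in> acarrier A"
  shows "aadd (alg_quot A I) (alg_coset A I x) (alg_coset A I y) = alg_coset A I (aadd A x y)"
proof -
  have "alg_coset A I (aadd A x' y') = alg_coset A I (aadd A x y)"
    if x': "x' \<in> alg_coset A I x" and y': "y' \<in> alg_coset A I y" for x' y'
  proof -
    obtain i j where i: "i \<in> I" "x' = aadd A x i" and j: "j \<in> I" "y' = aadd A y j"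
      using x' y' unfolding mem_coset by blast
    have ic: "i \<in> acarrier A" and jc: "j \<in> acarrier A" using ideal_carrier i(1) j(1) by auto
    have "aadd A x' y' = aadd A (aadd A x y) (aadd A i j)"
      unfolding i j using x y ic jc
      by (smt (verit) add_assoc add_closed add_commute)
    moreover have "aadd A i j \<in> I" using I i j unfolding alg_ideal_def by blast
    ultimately show ?thesis using coset_absorb add_closed x y by simp
  qed
  then have "(\<Union>x'\<in>alg_coset A I x. \<Union>y'\<in>alg_coset A I y. alg_coset A I (aadd A x' y')) =
      alg_coset A I (aadd A x y)"
    using coset_self[OF x] coset_self[OF y] by blast
  then show ?thesis by (simp add: alg_quot_def)
qed

lemma quot_mult:
  assumes x: "x \<in> acarrier A" and y: "y \<in> acarrier A"
  shows "amult (alg_quot A I) (alg_coset A I x) (alg_coset A I y) = alg_coset A I (amult A x y)"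
proof -
  have "alg_coset A I (amult A x' y') = alg_coset A I (amult A x y)"
    if x': "x' \<in> alg_coset A I x" and y': "y' \<in> alg_coset A I y" for x' y'
  proof -
    obtain i j where i: "i \<in> I" "x' = aadd A x i" and j: "j \<in> I" "y' = aadd A y j"
      using x' y' unfolding mem_coset by blast
    have ic: "i \<in> acarrier A" and jc: "j \<in> acarrier A" using ideal_carrier i(1) j(1) by auto
    have xj: "amult A x j \<in> I" and iy: "amult A i y' \<in> I"
      using I x y i j ic jc unfolding alg_ideal_def by (auto simp: add_closed)
    have y'c: "y' \<in> acarrier A" using j y jc add_closed by simp
    \<comment> \<open>Splitting only the left factor, with \<open>y'\<close> kept whole, leaves the
      two corrections \<open>i y'\<close> and \<open>x j\<close>, both in the ideal.\<close>
    have "amult A x' y' = aadd A (amult A x y') (amult A i y')"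
      unfolding i using x y'c ic by (simp add: mult_add_left)
    also have "amult A x y' = aadd A (amult A x y) (amult A x j)"
      unfolding j using x y jc by (simp add: mult_add_right)
    finally show ?thesis
      using xj iy coset_absorb x y mult_closed add_closed ideal_carrier by simp
  qed
  then have "(\<Union>x'\<in>alg_coset A I x. \<Union>y'\<in>alg_coset A I y. alg_coset A I (amult A x' y')) =
      alg_coset A I (amult A x y)"
    using coset_self[OF x] coset_self[OF y] by blast
  then show ?thesis by (simp add: alg_quot_def)
qed

lemma quot_scale:
  assumes x: "x \<in> acarrier A"
  shows "ascale (alg_quot A I) c (alg_coset A I x) = alg_coset A I (ascale A c x)"
proof -
  have "alg_coset A I (ascale A c x') = alg_coset A I (ascale A c x)"
    if x': "x' \<in> alg_coset A I x" for x'
  proof -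
    obtain i where i: "i \<in> I" "x' = aadd A x i" using x' unfolding mem_coset by blast
    have "ascale A c x' = aadd A (ascale A c x) (ascale A c i)"
      unfolding i using x ideal_carrier i(1) by (simp add: scale_add)
    moreover have "ascale A c i \<in> I" using I i unfolding alg_ideal_def by blast
    ultimately show ?thesis using coset_absorb x scale_closed by simp
  qed
  then have "(\<Union>x'\<in>alg_coset A I x. alg_coset A I (ascale A c x')) = alg_coset A I (ascale A c x)"
    using coset_self[OF x] by blast
  then show ?thesis by (simp add: alg_quot_def)
qed

lemmas quot_simps = quot_carrier quot_zero quot_add quot_mult quot_scale

text \<open>Preservation of the laws lets the construction be iterated: the Leavitt algebra is a
  quotient of a quotient.\<close>

lemma kalg_laws_quot: "kalg_laws (alg_quot A I)"
proof unfold_locales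
  fix x y assume "x \<in> acarrier (alg_quot A I)" "y \<in> acarrier (alg_quot A I)"
  then show "aadd (alg_quot A I) x y = aadd (alg_quot A I) y x"
    by (auto simp: quot_simps add_commute)
qed (auto simp: quot_simps zero_closed add_closed mult_closed scale_closed
     add_assoc add_zero add_neg scale_add mult_assoc mult_add_right mult_add_left
     mult_scale_right mult_scale_left)

end

end

section \<open>Traces on a quotient algebra\<close>

text \<open>The trace property makes the second condition two-sided.\<close>

lemma (in kalg_laws) alg_ideal_trace_radical:
  assumes T: "linear_trace scale A T" and scale: "k_algebra scale"
  shows "alg_ideal A {x \<in> acarrier A. T x = 0 \<and> (\<forall>a\<in>acarrier A. T (amult A a x) = 0)}"
    (is "alg_ideal A ?J")
proof -
  interpret R: k_algebra scale by (rule scale)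
  have T_add: "T (aadd A x y) = T x + T y" if "x \<in> acarrier A" "y \<in> acarrier A" for x y
    using T that unfolding linear_trace_def by blast
  have T_scale: "T (ascale A c x) = scale c (T x)" if "x \<in> acarrier A" for x c
    using T that unfolding linear_trace_def by blast
  have T_comm: "T (amult A x y) = T (amult A y x)" if "x \<in> acarrier A" "y \<in> acarrier A" for x y
    using T that unfolding linear_trace_def by blast
  have T_zero: "T (azero A) = 0"
    using T_add[OF zero_closed zero_closed] add_zero[OF zero_closed] by simp
  have T_mult_zero: "T (amult A a (azero A)) = 0" if "a \<in> acarrier A" for a
  proof -
    have "amult A a (azero A) = aadd A (amult A a (azero A)) (amult A a (azero A))"
      using mult_add_right[OF that zero_closed zero_closed] add_zero[OF zero_closed] by simp
    then show ?thesis
      using T_add[of "amult A a (azero A)" "amult A a (azero A)"] that mult_closed zero_closed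
      by simp
  qed
  show ?thesis
    unfolding alg_ideal_def
  proof (intro conjI ballI allI)
    show "azero A \<in> ?J" using T_zero T_mult_zero zero_closed by blast
  next
    fix x y assume "x \<in> ?J" "y \<in> ?J"
    then show "aadd A x y \<in> ?J" by (simp add: add_closed mult_add_right T_add mult_closed)
  next
    fix c x assume "x \<in> ?J"
    then show "ascale A c x \<in> ?J" by (simp add: scale_closed mult_scale_right T_scale mult_closed)
  next
    fix a x assume a: "a \<in> acarrier A" and "x \<in> ?J"
    then have x: "x \<in> acarrier A" "T x = 0" "\<And>b. b \<in> acarrier A \<Longrightarrow> T (amult A b x) = 0" by auto
    have "T (amult A b (amult A a x)) = 0" if "b \<in> acarrier A" for b
      using a x that by (metis mult_assoc mult_closed)
    then show "amult A a x \<in> ?J" using a x mult_closed by blast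
    have "T (amult A b (amult A x a)) = 0" if "b \<in> acarrier A" for b
      using a x that by (metis mult_assoc mult_closed T_comm)
    moreover have "T (amult A x a) = 0" using a x T_comm by metis
    ultimately show "amult A x a \<in> ?J" using a x mult_closed by blast
  qed auto
qed

text \<open>For surjectivity, the elements on which \<open>T\<close> and all its left translates
  vanish form an ideal containing \<open>X\<close>, hence containing the generated ideal by
  minimality. Thus \<open>T\<close> is constant on cosets, and no description of the generated ideal
  by sums of products is involved.\<close>

lemma (in kalg_laws) bij_betw_traces_quot:
  fixes scale :: "'k \<Rightarrow> 'r::ring \<Rightarrow> 'r"
  assumes scale: "k_algebra scale" and X: "X \<subseteq> acarrier A"
  defines "I \<equiv> gen_ideal A X"
  shows "bij_betw (\<lambda>t. \<lambda>x\<in>acarrier A. t (alg_coset A I x))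
    {t. linear_trace scale (alg_quot A I) t}
    {T. linear_trace scale A T \<and> (\<forall>x\<in>X. T x = 0 \<and> (\<forall>a\<in>acarrier A. T (amult A a x) = 0))}"
    (is "bij_betw ?f ?L ?R")
proof -
  interpret R: k_algebra scale by (rule scale)
  have I: "alg_ideal A I" unfolding I_def using alg_ideal_gen[OF X] .
  note qs = quot_simps[OF I]
  have coset_zero: "alg_coset A I x = alg_coset A I (azero A)" if "x \<in> I" for x
    using coset_absorb[OF I zero_closed that] that ideal_carrier[OF I that]
      add_zero add_commute zero_closed by metis
  show ?thesis
  proof (rule bij_betw_imageI)
    show "inj_on ?f ?L"
    proof (rule inj_onI)
      fix s t assume s: "s \<in> ?L" and t: "t \<in> ?L" and eq: "?f s = ?f t"
      have "s y = t y" if "y \<in> acarrier (alg_quot A I)" for y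
      proof -
        obtain x where x: "x \<in> acarrier A" "y = alg_coset A I x"
          using \<open>y \<in> acarrier (alg_quot A I)\<close> unfolding qs by blast
        show ?thesis using fun_cong[OF eq, of x] x by simp
      qed
      then show "s = t"
        using s t extensionalityI[of s "acarrier (alg_quot A I)" t]
        unfolding linear_trace_def by blast
    qed
    show "?f ` ?L = ?R"
    proof (intro equalityI subsetI)
      fix T assume "T \<in> ?f ` ?L"
      then obtain t where t: "linear_trace scale (alg_quot A I) t" and T: "T = ?f t" by blast
      have t_add: "t (alg_coset A I (aadd A x y)) = t (alg_coset A I x) + t (alg_coset A I y)"
        if "x \<in> acarrier A" "y \<in> acarrier A" for x y
        using t that unfolding linear_trace_def qs(1) by (auto simp: qs)
      have t_scale: "t (alg_coset A I (ascale A c x)) = scale c (t (alg_coset A I x))"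
        if "x \<in> acarrier A" for x c
        using t that unfolding linear_trace_def qs(1) by (auto simp: qs)
      have t_mult: "t (alg_coset A I (amult A x y)) = t (alg_coset A I (amult A y x))"
        if "x \<in> acarrier A" "y \<in> acarrier A" for x y
        using t that unfolding linear_trace_def qs(1) by (auto simp: qs)
      have t_zero: "t (alg_coset A I (azero A)) = 0"
        using t_add[OF zero_closed zero_closed] add_zero[OF zero_closed] by simp
      have "T x = 0" if "x \<in> I" for x
        using coset_zero[OF that] t_zero ideal_carrier[OF I that] unfolding T by simp
      moreover have "X \<subseteq> I" unfolding I_def by (rule gen_ideal_superset)
      moreover have "amult A a x \<in> I" if "x \<in> I" "a \<in> acarrier A" for a x
        using I that unfolding alg_ideal_def by blast
      moreover have "linear_trace scale A T"
        unfolding linear_trace_def T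
        by (auto simp: add_closed scale_closed mult_closed t_add t_scale t_mult)
      ultimately show "T \<in> ?R" by blast
    next
      fix T assume "T \<in> ?R"
      then have T: "linear_trace scale A T"
        and X0: "\<And>x. x \<in> X \<Longrightarrow> T x = 0"
        and X1: "\<And>x a. x \<in> X \<Longrightarrow> a \<in> acarrier A \<Longrightarrow> T (amult A a x) = 0" by auto
      have "I \<subseteq> {x \<in> acarrier A. T x = 0 \<and> (\<forall>a\<in>acarrier A. T (amult A a x) = 0)}"
        unfolding I_def
        by (rule gen_ideal_least[OF alg_ideal_trace_radical[OF T scale]]) (use X X0 X1 in auto)
      then have T_I: "T i = 0" if "i \<in> I" for i using that by blast
      have T_coset: "T y = T x" if "x \<in> acarrier A" "y \<in> alg_coset A I x" for x y
        using that T T_I ideal_carrier[OF I] unfolding linear_trace_def mem_coset[OF I] by auto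
      \<comment> \<open>Any representative serves, by \<open>T_coset\<close>; the restriction to the
        carrier supplies the extensionality that \<open>linear_trace\<close> demands.\<close>
      define t where "t = (\<lambda>Y\<in>acarrier (alg_quot A I). T (SOME y. y \<in> Y))"
      have t: "t (alg_coset A I x) = T x" if "x \<in> acarrier A" for x
      proof -
        have "(SOME y. y \<in> alg_coset A I x) \<in> alg_coset A I x"
          using coset_self[OF I that] by (rule someI)
        then show ?thesis using T_coset[OF that] that unfolding t_def qs by simp
      qed
      have "linear_trace scale (alg_quot A I) t"
        unfolding linear_trace_def
      proof (intro conjI ballI allI)
        show "t \<in> extensional (acarrier (alg_quot A I))" by (simp add: t_def)
      qed (use T in \<open>auto simp: qs t add_closed scale_closed mult_closed linear_trace_def\<close>)
      moreover have "?f t = T"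
        by (rule extensionalityI[of _ "acarrier A"])
           (use T in \<open>auto simp: t linear_trace_def\<close>)
      ultimately show "T \<in> ?f ` ?L" by blast
    qed
  qed
qed


section \<open>Traces on semigroup algebras\<close>

lemma semigroup_alg_simps [simp]:
  "acarrier (semigroup_alg S m) = {f. Poly_Mapping.keys f \<subseteq> S}"
  "azero (semigroup_alg S m) = 0"
  "aadd (semigroup_alg S m) = (+)"
  "ascale (semigroup_alg S m) c = Poly_Mapping.map ((*) c)"
  by (simp_all add: semigroup_alg_def)

lemma lookup_map_mult [simp]:
  "Poly_Mapping.lookup (Poly_Mapping.map ((*) (c::'k::field)) f) x = c * Poly_Mapping.lookup f x"
  by transfer (simp add: when_def)

lemma keys_map_mult: "Poly_Mapping.keys (Poly_Mapping.map ((*) (c::'k::field)) f) \<subseteq> Poly_Mapping.keys f"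
  by (auto simp: in_keys_iff)

text \<open>Reduces statements about linear combinations to basis elements. Supports stay inside
  \<open>S\<close> throughout because the semigroup laws are available only there.\<close>

lemma poly_mapping_keys_induct [consumes 1, case_names zero single add]:
  fixes f :: "'a \<Rightarrow>\<^sub>0 'b::comm_monoid_add"
  assumes "Poly_Mapping.keys f \<subseteq> S"
    and zero: "P 0"
    and single: "\<And>a c. a \<in> S \<Longrightarrow> P (Poly_Mapping.single a c)"
    and add: "\<And>f g. Poly_Mapping.keys f \<subseteq> S \<Longrightarrow> Poly_Mapping.keys g \<subseteq> S \<Longrightarrow> P f \<Longrightarrow> P g \<Longrightarrow> P (f + g)"
  shows "P f"
  using assms(1)
proof (induction f rule: update_induct)
  case const
  then show ?case by (simp add: zero)
next
  case (update f a b)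
  have "Poly_Mapping.update a b f = Poly_Mapping.single a b + f"
    by (rule poly_mapping_eqI)
       (use update.hyps in \<open>auto simp: lookup_update lookup_add lookup_single in_keys_iff when_def\<close>)
  moreover have "a \<in> S" "Poly_Mapping.keys f \<subseteq> S"
    using update.prems update.hyps by (auto simp: keys_update split: if_splits)
  ultimately show ?case
    using add[of "Poly_Mapping.single a b" f] single[of a b] update.IH by simp
qed

context
  fixes S :: "'g set" and m :: "'g \<Rightarrow> 'g \<Rightarrow> 'g"
  assumes closed: "a \<in> S \<Longrightarrow> b \<in> S \<Longrightarrow> m a b \<in> S"
    and assoc: "a \<in> S \<Longrightarrow> b \<in> S \<Longrightarrow> c \<in> S \<Longrightarrow> m (m a b) c = m a (m b c)"
begin

abbreviation (input) alg :: "('k::field, 'g \<Rightarrow>\<^sub>0 'k) kalg" where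
  "alg \<equiv> semigroup_alg S m"

text \<open>The product is defined by sums over exact supports, and supports may shrink by
  cancellation when elements are added. Padding with zero terms provides a common index set, from
  which distributivity is immediate.\<close>

lemma semigroup_alg_mult_eq:
  fixes f h :: "'g \<Rightarrow>\<^sub>0 'k::field"
  assumes "finite A" "Poly_Mapping.keys f \<subseteq> A" "finite B" "Poly_Mapping.keys h \<subseteq> B"
  shows "amult alg f h = (\<Sum>a\<in>A. \<Sum>b\<in>B.
    Poly_Mapping.single (m a b) (Poly_Mapping.lookup f a * Poly_Mapping.lookup h b))"
proof -
  have "amult alg f h = (\<Sum>a\<in>Poly_Mapping.keys f. \<Sum>b\<in>B.
    Poly_Mapping.single (m a b) (Poly_Mapping.lookup f a * Poly_Mapping.lookup h b))"
    unfolding semigroup_alg_def kalg.simps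
    by (intro sum.cong HOL.refl sum.mono_neutral_left) (use assms in \<open>auto simp: in_keys_iff\<close>)
  also have "\<dots> = (\<Sum>a\<in>A. \<Sum>b\<in>B.
    Poly_Mapping.single (m a b) (Poly_Mapping.lookup f a * Poly_Mapping.lookup h b))"
    by (intro sum.mono_neutral_left) (use assms in \<open>auto simp: in_keys_iff\<close>)
  finally show ?thesis .
qed

lemma semigroup_alg_mult_single:
  "amult alg (Poly_Mapping.single a x) (Poly_Mapping.single b (y::'k::field)) =
    Poly_Mapping.single (m a b) (x * y)"
  by (subst semigroup_alg_mult_eq[of "{a}" _ "{b}"]) auto

lemma semigroup_alg_mult_add_right:
  fixes f g h :: "'g \<Rightarrow>\<^sub>0 'k::field"
  shows "amult alg f (g + h) = amult alg f g + amult alg f h"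
proof -
  let ?B = "Poly_Mapping.keys g \<union> Poly_Mapping.keys h"
  have B: "finite ?B" "Poly_Mapping.keys g \<subseteq> ?B" "Poly_Mapping.keys h \<subseteq> ?B"
      "Poly_Mapping.keys (g + h) \<subseteq> ?B"
    using keys_add[of g h] by auto
  show ?thesis
    using semigroup_alg_mult_eq[OF finite_keys order_refl B(1), of _ f] B
    by (simp add: lookup_add algebra_simps single_add sum.distrib)
qed

lemma semigroup_alg_mult_add_left:
  fixes f g h :: "'g \<Rightarrow>\<^sub>0 'k::field"
  shows "amult alg (g + h) f = amult alg g f + amult alg h f"
proof -
  let ?B = "Poly_Mapping.keys g \<union> Poly_Mapping.keys h"
  have B: "finite ?B" "Poly_Mapping.keys g \<subseteq> ?B" "Poly_Mapping.keys h \<subseteq> ?B"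
      "Poly_Mapping.keys (g + h) \<subseteq> ?B"
    using keys_add[of g h] by auto
  show ?thesis
    using semigroup_alg_mult_eq[OF B(1) _ finite_keys order_refl, of _ f] B
    by (simp add: lookup_add algebra_simps single_add sum.distrib)
qed

lemma semigroup_alg_mult_zero:
  "amult alg f (0 :: 'g \<Rightarrow>\<^sub>0 'k::field) = 0" "amult alg (0 :: 'g \<Rightarrow>\<^sub>0 'k::field) f = 0"
  by (simp_all add: semigroup_alg_def)

lemma map_mult_sum:
  "Poly_Mapping.map ((*) (c::'k::field)) (\<Sum>i\<in>I. f i) = (\<Sum>i\<in>I. Poly_Mapping.map ((*) c) (f i))"
  by (rule poly_mapping_eqI) (simp add: lookup_sum sum_distrib_left)

lemma semigroup_alg_mult_closed:
  fixes f h :: "'g \<Rightarrow>\<^sub>0 'k::field"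
  assumes "Poly_Mapping.keys f \<subseteq> S" "Poly_Mapping.keys h \<subseteq> S"
  shows "Poly_Mapping.keys (amult alg f h) \<subseteq> S"
  using assms(1)
proof (induction f rule: poly_mapping_keys_induct)
  case zero then show ?case by (simp add: semigroup_alg_mult_zero)
next
  case (single a x)
  show ?case using assms(2)
  proof (induction h rule: poly_mapping_keys_induct)
    case zero then show ?case by (simp add: semigroup_alg_mult_zero)
  next
    case (single b y) then show ?case using \<open>a \<in> S\<close> by (simp add: semigroup_alg_mult_single closed)
  next
    case (add f g)
    then show ?case unfolding semigroup_alg_mult_add_right by (intro order_trans[OF keys_add]) simp
  qed
next
  case (add f g)
  then show ?case unfolding semigroup_alg_mult_add_left by (intro order_trans[OF keys_add]) simp
qed

lemma semigroup_alg_mult_assoc: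
  fixes f g h :: "'g \<Rightarrow>\<^sub>0 'k::field"
  assumes f: "Poly_Mapping.keys f \<subseteq> S" and g: "Poly_Mapping.keys g \<subseteq> S"
    and h: "Poly_Mapping.keys h \<subseteq> S"
  shows "amult alg (amult alg f g) h = amult alg f (amult alg g h)"
  using f
proof (induction f rule: poly_mapping_keys_induct)
  case zero then show ?case by (simp add: semigroup_alg_mult_zero)
next
  case a: (single a x)
  show ?case using g
  proof (induction g rule: poly_mapping_keys_induct)
    case zero then show ?case by (simp add: semigroup_alg_mult_zero)
  next
    case b: (single b y)
    show ?case using h
    proof (induction h rule: poly_mapping_keys_induct)
      case zero then show ?case by (simp add: semigroup_alg_mult_zero)
    next
      case (single c z)
      with a b show ?case by (simp add: semigroup_alg_mult_single assoc mult.assoc)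
    qed (simp add: semigroup_alg_mult_add_right)
  qed (simp add: semigroup_alg_mult_add_right semigroup_alg_mult_add_left)
qed (simp add: semigroup_alg_mult_add_left)

lemma kalg_laws_semigroup_alg: "kalg_laws (alg :: ('k::field, _) kalg)"
proof
  fix x y :: "'g \<Rightarrow>\<^sub>0 'k" and c :: 'k
  assume x: "x \<in> acarrier alg" and y: "y \<in> acarrier alg"
  show "aadd alg x y \<in> acarrier alg" using x y keys_add[of x y] by auto
  show "amult alg x y \<in> acarrier alg" using x y semigroup_alg_mult_closed by simp
  show "ascale alg c (aadd alg x y) = aadd alg (ascale alg c x) (ascale alg c y)"
    by (simp, rule poly_mapping_eqI) (simp add: lookup_add algebra_simps)
  have kc: "Poly_Mapping.keys (Poly_Mapping.map ((*) c) f) \<subseteq> Poly_Mapping.keys f"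
    for f :: "'g \<Rightarrow>\<^sub>0 'k" by (rule keys_map_mult)
  have ms: "Poly_Mapping.map ((*) c) (Poly_Mapping.single a z) = Poly_Mapping.single a (c * z)"
    for a :: 'g and z by simp
  show "amult alg x (ascale alg c y) = ascale alg c (amult alg x y)"
    using semigroup_alg_mult_eq[OF finite_keys order_refl finite_keys kc, of x y]
      semigroup_alg_mult_eq[OF finite_keys order_refl finite_keys order_refl, of x y]
    by (simp add: map_mult_sum ms algebra_simps)
  show "amult alg (ascale alg c x) y = ascale alg c (amult alg x y)"
    using semigroup_alg_mult_eq[OF finite_keys kc finite_keys order_refl, of x y]
      semigroup_alg_mult_eq[OF finite_keys order_refl finite_keys order_refl, of x y]
    by (simp add: map_mult_sum ms algebra_simps)
next
  fix x :: "'g \<Rightarrow>\<^sub>0 'k" and c :: 'k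
  assume x: "x \<in> acarrier alg"
  show "ascale alg c x \<in> acarrier alg" using x keys_map_mult[of c x] by auto
  show "aadd alg x (ascale alg (- 1) x) = azero alg"
    by (simp, rule poly_mapping_eqI) (simp add: lookup_add)
qed (auto simp: semigroup_alg_mult_add_right semigroup_alg_mult_add_left
      semigroup_alg_mult_assoc add_ac)

section \<open>Traces and their values on basis elements\<close>

lemma semigroup_alg_trace_eqI:
  fixes T U :: "('g \<Rightarrow>\<^sub>0 'k::field) \<Rightarrow> 'r::ring"
  assumes "\<And>f g. Poly_Mapping.keys f \<subseteq> S \<Longrightarrow> Poly_Mapping.keys g \<subseteq> S \<Longrightarrow> T (f + g) = T f + T g"
    and "\<And>f g. Poly_Mapping.keys f \<subseteq> S \<Longrightarrow> Poly_Mapping.keys g \<subseteq> S \<Longrightarrow> U (f + g) = U f + U g"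
    and "\<And>c f. Poly_Mapping.keys f \<subseteq> S \<Longrightarrow> T (Poly_Mapping.map ((*) c) f) = scale c (T f)"
    and "\<And>c f. Poly_Mapping.keys f \<subseteq> S \<Longrightarrow> U (Poly_Mapping.map ((*) c) f) = scale c (U f)"
    and eq: "\<And>a. a \<in> S \<Longrightarrow> T (Poly_Mapping.single a 1) = U (Poly_Mapping.single a 1)"
    and f: "Poly_Mapping.keys f \<subseteq> S"
  shows "T f = U f"
  using f
proof (induction f rule: poly_mapping_keys_induct)
  case zero
  have "T 0 = 0" using assms(1)[of 0 0] by simp
  moreover have "U 0 = 0" using assms(2)[of 0 0] by simp
  ultimately show ?case by simp
next
  case (single a c)
  then have "Poly_Mapping.keys (Poly_Mapping.single a (1::'k)) \<subseteq> S" by simp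
  from assms(3)[OF this, of c] assms(4)[OF this, of c] eq[OF single] show ?case by simp
qed (use assms in auto)

text \<open>The trace identity is bilinear, so it holds as soon as it holds for pairs of basis
  elements, and these multiply like the semigroup. The inverse map is linear extension.\<close>

lemma bij_betw_traces_semigroup_alg:
  fixes scale :: "'k::field \<Rightarrow> 'r::ring \<Rightarrow> 'r"
  assumes scale: "k_algebra scale"
  shows "bij_betw (\<lambda>T. \<lambda>g\<in>S. T (Poly_Mapping.single g 1))
    {T. linear_trace scale alg T}
    {\<delta> \<in> extensional S. \<forall>a\<in>S. \<forall>b\<in>S. \<delta> (m a b) = \<delta> (m b a)}"
    (is "bij_betw ?f ?L ?R")
proof -
  interpret R: k_algebra scale by (rule scale)
  interpret A: kalg_laws "alg :: ('k, _) kalg" by (rule kalg_laws_semigroup_alg)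
  show ?thesis
  proof (rule bij_betw_imageI)
    show "inj_on ?f ?L"
    proof (rule inj_onI)
      fix T U assume T: "T \<in> ?L" and U: "U \<in> ?L" and eq: "?f T = ?f U"
      have eq: "T (Poly_Mapping.single a 1) = U (Poly_Mapping.single a 1)" if "a \<in> S" for a
        using fun_cong[OF eq, of a] that by simp
      have "T f = U f" if "Poly_Mapping.keys f \<subseteq> S" for f
        by (rule semigroup_alg_trace_eqI[where scale = scale])
           (use T U eq that in \<open>auto simp: linear_trace_def\<close>)
      then show "T = U"
        using T U extensionalityI[of T "acarrier alg" U] by (simp add: linear_trace_def)
    qed
    show "?f ` ?L = ?R"
    proof (intro equalityI subsetI)
      fix \<delta> assume "\<delta> \<in> ?f ` ?L"
      then obtain T where T: "linear_trace scale alg T" and \<delta>: "\<delta> = ?f T" by blast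
      have "\<delta> (m a b) = \<delta> (m b a)" if "a \<in> S" "b \<in> S" for a b
      proof -
        have "T (amult alg (Poly_Mapping.single a 1) (Poly_Mapping.single b 1)) =
            T (amult alg (Poly_Mapping.single b 1) (Poly_Mapping.single a 1))"
          using T that unfolding linear_trace_def by simp
        then show ?thesis using that by (simp add: \<delta> closed semigroup_alg_mult_single)
      qed
      then show "\<delta> \<in> ?R" by (simp add: \<delta>)
    next
      fix \<delta> assume \<delta>: "\<delta> \<in> ?R"
      \<comment> \<open>The linear extension is defined on all finitely supported functions and
        restricted to the carrier only in \<open>?T\<close>; additivity and homogeneity thus hold
        without bounds on supports.\<close>
      define L where "L f = (\<Sum>a\<in>Poly_Mapping.keys f. scale (Poly_Mapping.lookup f a) (\<delta> a))" for f
      have L: "L f = (\<Sum>a\<in>A. scale (Poly_Mapping.lookup f a) (\<delta> a))"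
        if "finite A" "Poly_Mapping.keys f \<subseteq> A" for f A
        unfolding L_def
        by (rule sum.mono_neutral_left) (use that in \<open>auto simp: in_keys_iff\<close>)
      have L_add: "L (f + g) = L f + L g" for f g
      proof -
        let ?B = "Poly_Mapping.keys f \<union> Poly_Mapping.keys g"
        have "finite ?B" "Poly_Mapping.keys f \<subseteq> ?B" "Poly_Mapping.keys g \<subseteq> ?B"
            "Poly_Mapping.keys (f + g) \<subseteq> ?B"
          using keys_add[of f g] by auto
        then show ?thesis
          by (simp add: L[of ?B] lookup_add R.scale_left_distrib sum.distrib)
      qed
      have L_scale: "L (Poly_Mapping.map ((*) c) f) = scale c (L f)" for c f
        by (subst L[OF finite_keys keys_map_mult]) (simp add: L_def R.scale_sum_right)
      have L_single: "L (Poly_Mapping.single a c) = scale c (\<delta> a)" for a c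
        by (simp add: L[of "{a}"])
      have L_comm: "L (amult alg f g) = L (amult alg g f)"
        if f: "Poly_Mapping.keys f \<subseteq> S" and g: "Poly_Mapping.keys g \<subseteq> S" for f g
        using f
      proof (induction f rule: poly_mapping_keys_induct)
        case zero then show ?case by (simp add: semigroup_alg_mult_zero)
      next
        case a: (single a x)
        show ?case using g
        proof (induction g rule: poly_mapping_keys_induct)
          case zero then show ?case by (simp add: semigroup_alg_mult_zero)
        next
          case (single b y)
          with a \<delta> show ?case by (simp add: semigroup_alg_mult_single L_single mult.commute)
        qed (simp add: semigroup_alg_mult_add_right semigroup_alg_mult_add_left L_add)
      qed (simp add: semigroup_alg_mult_add_right semigroup_alg_mult_add_left L_add)
      let ?T = "\<lambda>f\<in>acarrier alg. L f"
      have "linear_trace scale alg ?T"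
        unfolding linear_trace_def
        using A.add_closed A.scale_closed A.mult_closed by (auto simp: L_add L_scale L_comm)
      moreover have "?f ?T = \<delta>"
        by (rule extensionalityI[of _ S]) (use \<delta> in \<open>auto simp: L_single\<close>)
      ultimately show "\<delta> \<in> ?f ` ?L" by blast
    qed
  qed
qed

text \<open>For fixed \<open>x\<close> the map taking \<open>a\<close> to \<open>T (a x)\<close> is
  linear, so basis elements test it. This turns a constraint coming from an ideal into one indexed
  by the semigroup.\<close>

lemma semigroup_alg_trace_mult_zero_iff:
  fixes scale :: "'k::field \<Rightarrow> 'r::ring \<Rightarrow> 'r"
  assumes scale: "k_algebra scale" and T: "linear_trace scale alg T"
    and x: "Poly_Mapping.keys x \<subseteq> S"
  shows "(\<forall>a\<in>acarrier alg. T (amult alg a x) = 0) \<longleftrightarrow>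
    (\<forall>g\<in>S. T (amult alg (Poly_Mapping.single g 1) x) = 0)"
proof -
  interpret R: k_algebra scale by (rule scale)
  interpret A: kalg_laws "alg :: ('k, _) kalg" by (rule kalg_laws_semigroup_alg)
  have T_add: "T (f + g) = T f + T g"
    if "Poly_Mapping.keys f \<subseteq> S" "Poly_Mapping.keys g \<subseteq> S" for f g
    using T that unfolding linear_trace_def by simp
  have "T (amult alg f x) = 0"
    if gens: "\<forall>g\<in>S. T (amult alg (Poly_Mapping.single g 1) x) = 0" and f: "Poly_Mapping.keys f \<subseteq> S"
    for f
    using f
  proof (induction f rule: poly_mapping_keys_induct)
    case zero
    then show ?case using T_add[of 0 0] by (simp add: semigroup_alg_mult_zero)
  next
    case (single g c)
    have g: "Poly_Mapping.single g 1 \<in> acarrier alg" using single by simp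
    have "Poly_Mapping.single g c = ascale alg c (Poly_Mapping.single g 1)" by simp
    then have "T (amult alg (Poly_Mapping.single g c) x) =
        T (ascale alg c (amult alg (Poly_Mapping.single g 1) x))"
      using A.mult_scale_left[OF g, of x c] x by simp
    also have "\<dots> = scale c (T (amult alg (Poly_Mapping.single g 1) x))"
      using T A.mult_closed[OF g, of x] x unfolding linear_trace_def by simp
    finally show ?case using gens single by simp
  next
    case (add f g)
    then show ?case
      using x by (simp add: semigroup_alg_mult_add_left T_add semigroup_alg_mult_closed)
  qed
  then show ?thesis by auto
qed

text \<open>The relation at a regular vertex has the shape \<open>h - (\<Sum>i\<in>I. k i)\<close>;
  products, supports and traces are prepared for this shape here and in the next two lemmas.\<close>

lemma semigroup_alg_mult_diff_sum:
  fixes f h :: "'g \<Rightarrow>\<^sub>0 'k::field"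
  shows "amult alg f (h - (\<Sum>i\<in>I. k i)) = amult alg f h - (\<Sum>i\<in>I. amult alg f (k i))"
proof -
  have "amult alg f (\<Sum>i\<in>I. k i) = (\<Sum>i\<in>I. amult alg f (k i))"
    by (induction I rule: infinite_finite_induct)
       (simp_all add: semigroup_alg_mult_zero semigroup_alg_mult_add_right)
  moreover have "amult alg f h = amult alg f (h - (\<Sum>i\<in>I. k i)) + amult alg f (\<Sum>i\<in>I. k i)"
    using semigroup_alg_mult_add_right[of f "h - (\<Sum>i\<in>I. k i)" "\<Sum>i\<in>I. k i"] by simp
  ultimately show ?thesis by simp
qed

lemma semigroup_alg_diff_sum_closed:
  assumes "Poly_Mapping.keys h \<subseteq> S" "\<And>i. i \<in> I \<Longrightarrow> Poly_Mapping.keys (k i) \<subseteq> S"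
  shows "Poly_Mapping.keys (h - (\<Sum>i\<in>I. k i) :: 'g \<Rightarrow>\<^sub>0 'k::field) \<subseteq> S"
proof
  fix x assume x: "x \<in> Poly_Mapping.keys (h - (\<Sum>i\<in>I. k i))"
  show "x \<in> S"
  proof (rule ccontr)
    assume "x \<notin> S"
    then have "Poly_Mapping.lookup h x = 0" "\<And>i. i \<in> I \<Longrightarrow> Poly_Mapping.lookup (k i) x = 0"
      using assms by (meson subsetD not_in_keys_iff_lookup_eq_zero)+
    then show False using x by (simp add: in_keys_iff lookup_minus lookup_sum)
  qed
qed

lemma semigroup_alg_trace_diff_sum:
  fixes scale :: "'k::field \<Rightarrow> 'r::ring \<Rightarrow> 'r"
  assumes T: "linear_trace scale alg T"
    and h: "Poly_Mapping.keys h \<subseteq> S" and k: "\<And>i. i \<in> I \<Longrightarrow> Poly_Mapping.keys (k i) \<subseteq> S"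
  shows "T (h - (\<Sum>i\<in>I. k i)) = T h - (\<Sum>i\<in>I. T (k i))"
proof -
  have T_add: "T (f + g) = T f + T g"
    if "Poly_Mapping.keys f \<subseteq> S" "Poly_Mapping.keys g \<subseteq> S" for f g
    using T that unfolding linear_trace_def by simp
  have T_zero: "T 0 = 0" using T_add[of 0 0] by simp
  have "Poly_Mapping.keys (\<Sum>i\<in>I. k i) \<subseteq> S \<and> T (\<Sum>i\<in>I. k i) = (\<Sum>i\<in>I. T (k i))"
    using k
  proof (induction I rule: infinite_finite_induct)
    case (insert i I)
    then have *: "Poly_Mapping.keys (k i) \<subseteq> S" "Poly_Mapping.keys (\<Sum>i\<in>I. k i) \<subseteq> S" by auto
    then have "Poly_Mapping.keys (k i + (\<Sum>i\<in>I. k i)) \<subseteq> S"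
      by (intro order_trans[OF keys_add]) simp
    then show ?case using insert * by (simp add: T_add)
  qed (simp_all add: T_zero)
  moreover have "T h = T (h - (\<Sum>i\<in>I. k i)) + T (\<Sum>i\<in>I. k i)"
    using T_add[OF semigroup_alg_diff_sum_closed[OF h k, of I "\<lambda>i. i"], of "\<Sum>i\<in>I. k i"]
      calculation by simp
  ultimately show ?thesis by simp
qed

end


section \<open>The graph inverse semigroup\<close>

lemma cat0_None [simp]: "cat0 a None = None" "cat0 None a = None"
  by (cases a; simp)+

lemma cat0_assoc: "cat0 (cat0 a b) c = cat0 a (cat0 b c)"
  by (cases a; cases b; cases c; simp)

lemma words0_None [simp]: "None \<in> words0 E"
  by (simp add: words0_def)

lemma words0_Some [simp]: "Some w \<in> words0 E \<longleftrightarrow> w \<noteq> [] \<and> set w \<subseteq> gens E"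
  by (auto simp: words0_def)

lemma cat0_closed: "a \<in> words0 E \<Longrightarrow> b \<in> words0 E \<Longrightarrow> cat0 a b \<in> words0 E"
  by (cases a; cases b; auto)

lemma gens_simps [simp]:
  "Vertex v \<in> gens E \<longleftrightarrow> v \<in> verts E"
  "Edge e \<in> gens E \<longleftrightarrow> e \<in> arcs E"
  "Ghost e \<in> gens E \<longleftrightarrow> e \<in> arcs E"
  by (auto simp: gens_def)

lemma pran_simps [simp]:
  "pran E (v, []) = v"
  "pran E (v, e # es) = pran E (head E e, es)"
  by (simp_all add: pran_def pre_digraph.awalk_verts.simps pre_digraph.awalk_verts_non_Nil)

lemma pran_append: "pran E (v, es @ fs) = pran E (pran E (v, es), fs)"
  by (induction es arbitrary: v) auto

fun star_gen :: "('v, 'e) gen \<Rightarrow> ('v, 'e) gen" where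
  "star_gen (Vertex v) = Vertex v"
| "star_gen (Edge e) = Ghost e"
| "star_gen (Ghost e) = Edge e"

definition star_word :: "('v, 'e) word0 \<Rightarrow> ('v, 'e) word0" where
  "star_word = map_option (rev \<circ> map star_gen)"

lemma star_gen_star_gen [simp]: "star_gen (star_gen g) = g"
  by (cases g) auto

lemma star_gen_in_gens [simp]: "star_gen g \<in> gens E \<longleftrightarrow> g \<in> gens E"
  by (cases g) auto

lemma star_word_simps [simp]:
  "star_word None = None"
  "star_word (Some w) = Some (rev (map star_gen w))"
  by (simp_all add: star_word_def)

lemma star_word_star_word [simp]: "star_word (star_word a) = a"
  by (cases a) (auto simp: rev_map comp_def)

lemma star_word_closed [simp]: "star_word a \<in> words0 E \<longleftrightarrow> a \<in> words0 E"
  by (cases a) auto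

lemma star_word_cat0: "star_word (cat0 a b) = cat0 (star_word b) (star_word a)"
  by (cases a; cases b; simp)

definition gis_star :: "('v, 'e) gis \<Rightarrow> ('v, 'e) gis" where
  "gis_star X = star_word ` X"

text \<open>
  Generators act as partial functions on pairs of a vertex and a list of arcs: an arc is put in
  front, a ghost arc is removed from the front. The pairs need not be paths.
\<close>

fun act_gen :: "('v, 'e) pre_digraph \<Rightarrow> ('v, 'e) gen \<Rightarrow> ('v, 'e) path \<Rightarrow> ('v, 'e) path option" where
  "act_gen E (Vertex v) x = (if fst x = v then Some x else None)"
| "act_gen E (Edge e) x = (if fst x = head E e then Some (tail E e, e # snd x) else None)"
| "act_gen E (Ghost e) x = (if fst x = tail E e \<and> snd x \<noteq> [] \<and> hd (snd x) = e
     then Some (head E e, tl (snd x)) else None)"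

text \<open>The rightmost letter acts first, so concatenation of words becomes composition of
  partial maps.\<close>

fun act_word :: "('v, 'e) pre_digraph \<Rightarrow> ('v, 'e) gen list \<Rightarrow> ('v, 'e) path \<Rightarrow> ('v, 'e) path option" where
  "act_word E [] x = Some x"
| "act_word E (g # w) x = Option.bind (act_word E w x) (act_gen E g)"

fun act_word0 :: "('v, 'e) pre_digraph \<Rightarrow> ('v, 'e) word0 \<Rightarrow> ('v, 'e) path \<Rightarrow> ('v, 'e) path option" where
  "act_word0 E None x = None"
| "act_word0 E (Some w) x = act_word E w x"

lemma act_word_append: "act_word E (u @ w) x = Option.bind (act_word E w x) (act_word E u)"
  by (cases "act_word E w x"; induction u) auto

lemma act_word0_cat0: "act_word0 E (cat0 a b) x = Option.bind (act_word0 E b x) (act_word0 E a)"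
proof (cases a)
  case None
  then show ?thesis by (cases "act_word0 E b x") auto
next
  case (Some u)
  then have "act_word0 E a = act_word E u" by auto
  then show ?thesis using Some by (cases b) (auto simp: act_word_append)
qed

text \<open>The vertex in the middle keeps the word nonempty when both paths have length 0, so one
  formula covers all cases.\<close>

definition nf_word :: "('v, 'e) pre_digraph \<Rightarrow> ('v, 'e) path \<Rightarrow> ('v, 'e) path \<Rightarrow> ('v, 'e) gen list" where
  "nf_word E p q = map Edge (snd p) @ Vertex (pran E p) # map Ghost (rev (snd q))"

text \<open>The element \<open>p q\<^sup>*\<close> of the semigroup, provided that \<open>p\<close> and \<open>q\<close> have the same range.\<close>

definition gnf :: "('v, 'e) pre_digraph \<Rightarrow> ('v, 'e) path \<Rightarrow> ('v, 'e) path \<Rightarrow> ('v, 'e) gis" where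
  "gnf E p q = gis_cls E (Some (nf_word E p q))"

abbreviation gedge :: "('v, 'e) pre_digraph \<Rightarrow> 'e \<Rightarrow> ('v, 'e) gis" where
  "gedge E e \<equiv> gis_cls E (Some [Edge e])"

abbreviation gghost :: "('v, 'e) pre_digraph \<Rightarrow> 'e \<Rightarrow> ('v, 'e) gis" where
  "gghost E e \<equiv> gis_cls E (Some [Ghost e])"

context wf_digraph
begin

abbreviation gmult (infixl "\<odot>" 70) where "x \<odot> y \<equiv> gis_mult G x y"

lemma Path_Nil [simp]: "(v, []) \<in> Path G \<longleftrightarrow> v \<in> verts G"
  by (auto simp: Path_def awalk_def intro!: exI[of _ v])

lemma Path_Cons [simp]:
  "(v, e # es) \<in> Path G \<longleftrightarrow> e \<in> arcs G \<and> tail G e = v \<and> (head G e, es) \<in> Path G"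
  by (auto simp: Path_def awalk_def)

lemma Path_append:
  "(v, es @ fs) \<in> Path G \<longleftrightarrow> (v, es) \<in> Path G \<and> (pran G (v, es), fs) \<in> Path G"
proof (induction es arbitrary: v)
  case Nil
  have "(v, fs) \<in> Path G \<Longrightarrow> v \<in> verts G" by (simp add: Path_def awalk_def)
  then show ?case by auto
qed auto

lemma psrc_in_verts: "p \<in> Path G \<Longrightarrow> fst p \<in> verts G"
  by (auto simp: Path_def awalk_def)

lemma pran_in_verts: "p \<in> Path G \<Longrightarrow> pran G p \<in> verts G"
proof -
  have "(v, es) \<in> Path G \<Longrightarrow> pran G (v, es) \<in> verts G" for v es
    by (induction es arbitrary: v) auto
  then show "p \<in> Path G \<Longrightarrow> pran G p \<in> verts G" by (cases p) simp
qed

lemma set_Path_subset: "p \<in> Path G \<Longrightarrow> set (snd p) \<subseteq> arcs G"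
  by (auto simp: Path_def awalk_def)

section \<open>The semigroup as a quotient of words\<close>

lemma gis_cong_words0: "(a, b) \<in> gis_cong G \<Longrightarrow> a \<in> words0 G \<and> b \<in> words0 G"
  by (induction rule: gis_cong.induct) (auto simp: cat0_closed)

lemma equiv_gis_cong: "equiv (words0 G) (gis_cong G)"
  by (rule equivI)
     (auto simp: refl_on_def sym_def trans_def gis_cong_words0
       intro: gis_cong.refl gis_cong.sym gis_cong.trans)

lemma gis_cls_eq_iff:
  "a \<in> words0 G \<Longrightarrow> b \<in> words0 G \<Longrightarrow> gis_cls G a = gis_cls G b \<longleftrightarrow> (a, b) \<in> gis_cong G"
  unfolding gis_cls_def using eq_equiv_class_iff[OF equiv_gis_cong] .

lemma gis_cls_eqI: "(a, b) \<in> gis_cong G \<Longrightarrow> gis_cls G a = gis_cls G b"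
  using gis_cls_eq_iff gis_cong_words0 by blast

lemma gis_cls_in_gis [simp]: "a \<in> words0 G \<Longrightarrow> gis_cls G a \<in> gis G"
  unfolding gis_cls_def gis_def by (rule quotientI)

lemma gisE:
  assumes "x \<in> gis G"
  obtains a where "a \<in> words0 G" "x = gis_cls G a"
  using assms unfolding gis_def gis_cls_def by (rule quotientE)

lemma gis_mult_cls [simp]:
  assumes "a \<in> words0 G" "b \<in> words0 G"
  shows "gis_cls G a \<odot> gis_cls G b = gis_cls G (cat0 a b)"
proof -
  have "gis_cls G (cat0 a' b') = gis_cls G (cat0 a b)"
    if "a' \<in> gis_cls G a" "b' \<in> gis_cls G b" for a' b'
  proof -
    have "(a, a') \<in> gis_cong G" "(b, b') \<in> gis_cong G" using that by (auto simp: gis_cls_def)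
    then have "(cat0 a b, cat0 a' b) \<in> gis_cong G" "(cat0 a' b, cat0 a' b') \<in> gis_cong G"
      using assms gis_cong_words0 by (auto intro: gis_cong.cat_left gis_cong.cat_right)
    then show ?thesis by (metis gis_cls_eqI)
  qed
  moreover have "a \<in> gis_cls G a" "b \<in> gis_cls G b"
    using assms by (auto simp: gis_cls_def intro: gis_cong.refl)
  ultimately show ?thesis unfolding gis_mult_def by blast
qed

lemma gis_mult_closed [simp]: "x \<in> gis G \<Longrightarrow> y \<in> gis G \<Longrightarrow> x \<odot> y \<in> gis G"
  by (elim gisE) (simp add: cat0_closed)

lemma gis_mult_assoc: "x \<in> gis G \<Longrightarrow> y \<in> gis G \<Longrightarrow> z \<in> gis G \<Longrightarrow> (x \<odot> y) \<odot> z = x \<odot> (y \<odot> z)"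
  by (elim gisE) (simp add: cat0_closed cat0_assoc)

lemma gis_zero_closed [simp]: "gis_zero G \<in> gis G"
  by (simp add: gis_zero_def)

lemma gis_mult_zero [simp]:
  "x \<in> gis G \<Longrightarrow> x \<odot> gis_zero G = gis_zero G"
  "x \<in> gis G \<Longrightarrow> gis_zero G \<odot> x = gis_zero G"
  by (elim gisE; simp add: gis_zero_def)+

lemma gen_closed [simp]:
  "v \<in> verts G \<Longrightarrow> gvert G v \<in> gis G"
  "e \<in> arcs G \<Longrightarrow> gedge G e \<in> gis G"
  "e \<in> arcs G \<Longrightarrow> gghost G e \<in> gis G"
  by (simp_all add: gvert_def)

lemma gvert_gvert [simp]: "v \<in> verts G \<Longrightarrow> w \<in> verts G \<Longrightarrow>
    gvert G v \<odot> gvert G w = (if v = w then gvert G v else gis_zero G)"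
  using gis_cls_eqI[OF gis_cong.vertex_vertex[of v G w]] by (auto simp: gvert_def gis_zero_def)

lemma gvert_gedge [simp]: "e \<in> arcs G \<Longrightarrow> gvert G (tail G e) \<odot> gedge G e = gedge G e"
  using gis_cls_eqI[OF gis_cong.source_edge[of e G]] by (simp add: gvert_def)

lemma gedge_gvert [simp]: "e \<in> arcs G \<Longrightarrow> gedge G e \<odot> gvert G (head G e) = gedge G e"
  using gis_cls_eqI[OF gis_cong.edge_range[of e G]] by (simp add: gvert_def)

lemma gvert_gghost [simp]: "e \<in> arcs G \<Longrightarrow> gvert G (head G e) \<odot> gghost G e = gghost G e"
  using gis_cls_eqI[OF gis_cong.range_ghost[of e G]] by (simp add: gvert_def)

lemma gghost_gvert [simp]: "e \<in> arcs G \<Longrightarrow> gghost G e \<odot> gvert G (tail G e) = gghost G e"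
  using gis_cls_eqI[OF gis_cong.ghost_source[of e G]] by (simp add: gvert_def)

lemma gghost_gedge [simp]: "e \<in> arcs G \<Longrightarrow> f \<in> arcs G \<Longrightarrow>
    gghost G e \<odot> gedge G f = (if e = f then gvert G (head G e) else gis_zero G)"
  using gis_cls_eqI[OF gis_cong.ghost_edge[of e G f]] by (auto simp: gvert_def gis_zero_def)

text \<open>Nonempty words are products of their letters. The rule serves properties closed under
  products, such as commuting with all elements under a given map.\<close>

lemma gis_induct [consumes 1, case_names zero vertex edge ghost mult]:
  assumes "x \<in> gis G"
    and "P (gis_zero G)"
    and "\<And>v. v \<in> verts G \<Longrightarrow> P (gvert G v)"
    and "\<And>e. e \<in> arcs G \<Longrightarrow> P (gedge G e)"
    and "\<And>e. e \<in> arcs G \<Longrightarrow> P (gghost G e)"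
    and mult: "\<And>x y. x \<in> gis G \<Longrightarrow> y \<in> gis G \<Longrightarrow> P x \<Longrightarrow> P y \<Longrightarrow> P (x \<odot> y)"
  shows "P x"
proof -
  have gen: "P (gis_cls G (Some [g]))" if "g \<in> gens G" for g
    using assms(3-5) that by (cases g) (auto simp: gvert_def)
  have "P (gis_cls G (Some w))" if "w \<noteq> []" "set w \<subseteq> gens G" for w
    using that
  proof (induction w rule: list_nonempty_induct)
    case (cons g w)
    then have "P (gis_cls G (Some [g]) \<odot> gis_cls G (Some w))"
      by (intro mult gen) auto
    with cons show ?case by simp
  qed (use gen in auto)
  moreover obtain a where "a \<in> words0 G" "x = gis_cls G a" using assms(1) by (rule gisE)
  ultimately show ?thesis using assms(2) by (cases a) (auto simp: gis_zero_def)
qed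


subsection \<open>The involution\<close>

text \<open>Reversal with edges and ghosts exchanged permutes the defining relations: the source
  relation of an edge goes to that of its ghost, the range relation likewise, and the two remaining
  families are mapped to themselves with their indices swapped.\<close>

lemma star_word_cong: "(a, b) \<in> gis_cong G \<Longrightarrow> (star_word a, star_word b) \<in> gis_cong G"
proof (induction rule: gis_cong.induct)
  case (vertex_vertex v w)
  then show ?case using gis_cong.vertex_vertex[of w G v] by auto
next
  case (ghost_edge e f)
  then show ?case using gis_cong.ghost_edge[of f G e] by auto
next
  case (cat_left a b c)
  then show ?case by (auto simp: star_word_cat0 intro: gis_cong.cat_right)
next
  case (cat_right a b c)
  then show ?case by (auto simp: star_word_cat0 intro: gis_cong.cat_left)
qed (auto intro: gis_cong.intros)

lemma gis_star_cls [simp]: "gis_star (gis_cls G a) = gis_cls G (star_word a)"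
proof -
  have "star_word ` gis_cls G a \<subseteq> gis_cls G (star_word a)" for a
    by (auto simp: gis_cls_def intro: star_word_cong)
  \<comment> \<open>Applied to \<open>star_word a\<close>, the inclusion yields the opposite one,
    because \<open>star_word\<close> is an involution.\<close>
  from this[of a] this[of "star_word a"] show ?thesis
    unfolding gis_star_def
    by (metis (no_types, lifting) image_eqI star_word_star_word subsetD subsetI subset_antisym)
qed

lemma gis_star_closed [simp]: "x \<in> gis G \<Longrightarrow> gis_star x \<in> gis G"
  by (elim gisE) simp

lemma gis_star_mult: "x \<in> gis G \<Longrightarrow> y \<in> gis G \<Longrightarrow> gis_star (x \<odot> y) = gis_star y \<odot> gis_star x"
  by (elim gisE) (simp add: cat0_closed star_word_cat0)

lemma gis_star_star [simp]: "gis_star (gis_star x) = x"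
  by (simp add: gis_star_def image_image)

lemma gis_star_simps [simp]:
  "gis_star (gis_zero G) = gis_zero G"
  "gis_star (gvert G v) = gvert G v"
  by (simp_all add: gis_zero_def gvert_def)


subsection \<open>Normal forms\<close>

lemma nf_word_closed: "p \<in> Path G \<Longrightarrow> q \<in> Path G \<Longrightarrow> Some (nf_word G p q) \<in> words0 G"
  using set_Path_subset[of p] set_Path_subset[of q] pran_in_verts[of p]
  by (auto simp: nf_word_def)

lemma gnf_closed [simp]: "p \<in> Path G \<Longrightarrow> q \<in> Path G \<Longrightarrow> gnf G p q \<in> gis G"
  using nf_word_closed by (simp add: gnf_def)

lemma gis_star_gnf: "pran G p = pran G q \<Longrightarrow> gis_star (gnf G p q) = gnf G q p"
  by (simp add: gnf_def nf_word_def rev_map comp_def)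

lemma gnf_Nil: "gnf G (v, []) (v, []) = gvert G v"
  by (simp add: gnf_def nf_word_def gvert_def)

lemma gnf_Cons_left:
  assumes "(v, e # es) \<in> Path G" "q \<in> Path G"
  shows "gnf G (v, e # es) q = gedge G e \<odot> gnf G (head G e, es) q"
  using assms nf_word_closed[of "(head G e, es)" q]
  by (simp add: gnf_def nf_word_def)

lemma gnf_Cons_right:
  assumes "p \<in> Path G" "(v, e # es) \<in> Path G"
  shows "gnf G p (v, e # es) = gnf G p (head G e, es) \<odot> gghost G e"
  using assms nf_word_closed[of p "(head G e, es)"]
  by (simp add: gnf_def nf_word_def)

text \<open>If \<open>p\<close> has a first edge, that edge absorbs the vertex. Otherwise the vertex
  is also the range of \<open>q\<close>, and induction on \<open>q\<close> strips ghosts off the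
  right end until only a product of equal vertices remains.\<close>

lemma gvert_gnf_self:
  assumes "p \<in> Path G" "q \<in> Path G" "pran G p = pran G q"
  shows "gvert G (fst p) \<odot> gnf G p q = gnf G p q"
proof (cases p)
  case (Pair v es)
  show ?thesis
  proof (cases es)
    case Nil
    have "gvert G (pran G (u, fs)) \<odot> gnf G (pran G (u, fs), []) (u, fs) =
        gnf G (pran G (u, fs), []) (u, fs)" if "(u, fs) \<in> Path G" for u fs
      using that
    proof (induction fs arbitrary: u)
      case (Cons f fs)
      then show ?case
        by (simp add: gnf_Cons_right pran_in_verts gis_mult_assoc[symmetric])
    qed (simp add: gnf_Nil)
    from this[of "fst q" "snd q"] show ?thesis using Pair Nil assms by simp
  next
    case (Cons e fs)
    then show ?thesis using Pair assms
      by (auto simp: gnf_Cons_left gis_mult_assoc[symmetric])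
  qed
qed

lemma gvert_gnf:
  assumes "v \<in> verts G" "p \<in> Path G" "q \<in> Path G" "pran G p = pran G q"
  shows "gvert G v \<odot> gnf G p q = (if v = fst p then gnf G p q else gis_zero G)"
proof -
  \<comment> \<open>Inserting the source of \<open>p\<close> leaves a product of two vertices, and
    vertices are orthogonal idempotents.\<close>
  have "gvert G v \<odot> gnf G p q = (gvert G v \<odot> gvert G (fst p)) \<odot> gnf G p q"
    using assms gvert_gnf_self[of p q] by (simp add: gis_mult_assoc psrc_in_verts del: gvert_gvert)
  then show ?thesis using assms gvert_gnf_self[of p q] by (auto simp: psrc_in_verts)
qed

lemma gedge_gnf:
  assumes "e \<in> arcs G" "p \<in> Path G" "q \<in> Path G" "pran G p = pran G q"
  shows "gedge G e \<odot> gnf G p q =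
    (if head G e = fst p then gnf G (tail G e, e # snd p) q else gis_zero G)"
proof -
  have "gedge G e \<odot> gnf G p q = gedge G e \<odot> (gvert G (head G e) \<odot> gnf G p q)"
    using assms by (simp add: gis_mult_assoc[symmetric])
  also have "\<dots> = (if head G e = fst p then gedge G e \<odot> gnf G p q else gis_zero G)"
    using assms by (simp add: gvert_gnf)
  also have "\<dots> = (if head G e = fst p then gnf G (tail G e, e # snd p) q else gis_zero G)"
    using assms by (cases p) (simp add: gnf_Cons_left)
  finally show ?thesis .
qed

text \<open>This is \<open>e* q* = (q e)*\<close>. The new edge goes to the far end of
  \<open>q\<close>, whereas \<open>gnf_Cons_right\<close> splits \<open>q\<close> at its first edge,
  hence the induction.\<close>

lemma gghost_gnf_Nil:
  assumes "e \<in> arcs G" "q \<in> Path G" "pran G q = tail G e"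
  shows "gghost G e \<odot> gnf G (tail G e, []) q = gnf G (head G e, []) (fst q, snd q @ [e])"
proof -
  have "gghost G e \<odot> gnf G (tail G e, []) (u, fs) = gnf G (head G e, []) (u, fs @ [e])"
    if "(u, fs) \<in> Path G" "pran G (u, fs) = tail G e" for u fs
    using that
  proof (induction fs arbitrary: u)
    case Nil
    then show ?case using assms(1) by (simp add: gnf_Cons_right gnf_Nil)
  next
    case (Cons f fs)
    have "(head G f, fs @ [e]) \<in> Path G"
      using Cons.prems assms(1) by (simp add: Path_append)
    then show ?case using Cons assms(1)
      by (simp add: gnf_Cons_right gis_mult_assoc[symmetric])
  qed
  then show ?thesis using assms by (cases q) auto
qed

lemma gghost_gnf_Nil_other:
  assumes "e \<in> arcs G" "q \<in> Path G" "pran G q = v" "v \<noteq> tail G e"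
  shows "gghost G e \<odot> gnf G (v, []) q = gis_zero G"
proof -
  have v: "v \<in> verts G" using assms pran_in_verts by blast
  have "gghost G e \<odot> gnf G (v, []) q = gghost G e \<odot> (gvert G (tail G e) \<odot> gnf G (v, []) q)"
    using assms v by (simp add: gis_mult_assoc[symmetric])
  then show ?thesis using assms v by (simp add: gvert_gnf)
qed

lemma gghost_gnf_Cons:
  assumes "e \<in> arcs G" "(v, f # es) \<in> Path G" "q \<in> Path G" "pran G (v, f # es) = pran G q"
  shows "gghost G e \<odot> gnf G (v, f # es) q =
    (if e = f then gnf G (head G f, es) q else gis_zero G)"
  using assms by (auto simp: gnf_Cons_left gis_mult_assoc[symmetric] gvert_gnf simp del: gis_mult_cls)

text \<open>The set of zero and all normal forms contains the generators and is stable under left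
  multiplication by them, so it contains the class of every word.\<close>

lemma gnf_cases:
  assumes "x \<in> gis G"
  obtains "x = gis_zero G"
    | p q where "p \<in> Path G" "q \<in> Path G" "pran G p = pran G q" "x = gnf G p q"
proof -
  define N where "N = insert (gis_zero G)
    {gnf G p q | p q. p \<in> Path G \<and> q \<in> Path G \<and> pran G p = pran G q}"
  have N: "gnf G p q \<in> N" if "p \<in> Path G" "q \<in> Path G" "pran G p = pran G q" for p q
    using that unfolding N_def by blast
  have zero: "gis_zero G \<in> N" unfolding N_def by blast
  have gen: "gis_cls G (Some [g]) \<odot> y \<in> N" if g: "g \<in> gens G" and y: "y \<in> N" for g y
  proof (cases "y = gis_zero G")
    case True
    then show ?thesis using g zero by simp
  next
    case False
    then obtain p q where p: "p \<in> Path G" and q: "q \<in> Path G" and pq: "pran G p = pran G q"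
      and y: "y = gnf G p q"
      using y unfolding N_def by blast
    show ?thesis
    proof (cases g)
      case (Vertex v)
      then show ?thesis using g p q pq N zero gvert_gnf[of v p q] by (auto simp: y gvert_def)
    next
      case (Edge e)
      have "gnf G (tail G e, e # snd p) q \<in> N" if "head G e = fst p"
        by (rule N) (use g Edge p q pq that in auto)
      then show ?thesis using g p q pq Edge zero gedge_gnf[of e p q] by (auto simp: y)
    next
      case (Ghost e)
      obtain v es where [simp]: "p = (v, es)" by (cases p)
      show ?thesis
      proof (cases es)
        case Nil
        have "gnf G (head G e, []) (fst q, snd q @ [e]) \<in> N" if "v = tail G e"
          by (rule N) (use g Ghost q pq that Nil in \<open>auto simp: Path_append pran_append\<close>)
        then show ?thesis
          using g p q pq Ghost zero Nil gghost_gnf_Nil[of e q] gghost_gnf_Nil_other[of e q v]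
          by (cases "v = tail G e") (auto simp: y)
      next
        case (Cons f fs)
        have "gnf G (head G f, fs) q \<in> N"
          by (rule N) (use p q pq Cons in auto)
        then show ?thesis
          using g p q pq Ghost zero gghost_gnf_Cons[of e v f fs q] by (auto simp: y Cons)
      qed
    qed
  qed
  have single: "gis_cls G (Some [g]) \<in> N" if g: "g \<in> gens G" for g
  proof (cases g)
    case (Vertex v)
    then show ?thesis using g N[of "(v, [])" "(v, [])"] by (simp add: gnf_Nil gvert_def)
  next
    \<comment> \<open>An edge, like a ghost, equals its product with the vertex to its right. That
      vertex is a normal form, so \<open>gen\<close> applies.\<close>
    case (Edge e)
    then show ?thesis
      using g gen[OF g N[of "(head G e, [])" "(head G e, [])"]] by (simp add: gnf_Nil)
  next
    case (Ghost e)
    then show ?thesis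
      using g gen[OF g N[of "(tail G e, [])" "(tail G e, [])"]] by (simp add: gnf_Nil)
  qed
  have "gis_cls G (Some w) \<in> N" if "w \<noteq> []" "set w \<subseteq> gens G" for w
    using that
  proof (induction w rule: list_nonempty_induct)
    case (cons g w)
    then show ?case using gen[of g "gis_cls G (Some w)"] by simp
  qed (use single in auto)
  moreover obtain a where "a \<in> words0 G" "x = gis_cls G a" using assms by (rule gisE)
  ultimately have "x \<in> N" using zero by (cases a) (auto simp: gis_zero_def)
  then show thesis using that unfolding N_def by blast
qed


subsection \<open>Uniqueness of normal forms\<close>

text \<open>Each defining relation is an identity of partial maps on all pairs, paths or not. The
  action is therefore an invariant of classes and can tell them apart.\<close>

lemma act_word0_cong: "(a, b) \<in> gis_cong G \<Longrightarrow> act_word0 G a = act_word0 G b"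
proof (induction rule: gis_cong.induct)
  case (cat_left a b c)
  then show ?case by (intro ext) (simp add: act_word0_cat0)
next
  case (cat_right a b c)
  then show ?case by (intro ext) (simp add: act_word0_cat0)
qed (auto simp: fun_eq_iff)

lemma gis_cls_act: "a \<in> words0 G \<Longrightarrow> b \<in> words0 G \<Longrightarrow> gis_cls G a = gis_cls G b \<Longrightarrow>
    act_word0 G a = act_word0 G b"
  using act_word0_cong gis_cls_eq_iff by blast

lemma act_edges: "(v, es) \<in> Path G \<Longrightarrow>
    act_word G (map Edge es) (pran G (v, es), zs) = Some (v, es @ zs)"
  by (induction es arbitrary: v) auto

text \<open>Ghosts strip \<open>fs\<close> edge by edge, so the map is defined exactly on the
  extensions of \<open>fs\<close>. For empty \<open>fs\<close> it is the leading
  \<open>Vertex\<close> that checks the source.\<close>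

lemma act_ghosts: "(u, fs) \<in> Path G \<Longrightarrow>
    act_word G (Vertex (pran G (u, fs)) # map Ghost (rev fs)) x = Some y \<longleftrightarrow>
      (\<exists>zs. x = (u, fs @ zs) \<and> y = (pran G (u, fs), zs))"
proof (induction fs arbitrary: u x)
  case Nil
  then show ?case by (cases x) auto
next
  case (Cons f fs)
  then have IH: "act_word G (Vertex (pran G (head G f, fs)) # map Ghost (rev fs)) x = Some y \<longleftrightarrow>
      (\<exists>zs. x = (head G f, fs @ zs) \<and> y = (pran G (head G f, fs), zs))" for x by simp
  have "act_word G (Vertex (pran G (u, f # fs)) # map Ghost (rev (f # fs))) x =
      Option.bind (act_gen G (Ghost f) x)
        (act_word G (Vertex (pran G (head G f, fs)) # map Ghost (rev fs)))"
    by (simp add: act_word_append)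
  then show ?case using IH Cons.prems
    by (cases x; cases "snd x") (auto simp del: act_word.simps simp: Option.bind_eq_Some_conv)
qed

text \<open>First the prefix \<open>q\<close> is removed, then \<open>p\<close> is put in front:
  \<open>p q*\<close> acts by exchanging prefixes.\<close>

lemma act_nf_word:
  assumes "p \<in> Path G" "q \<in> Path G" "pran G p = pran G q"
  shows "act_word G (nf_word G p q) x = Some y \<longleftrightarrow>
    (\<exists>zs. x = (fst q, snd q @ zs) \<and> y = (fst p, snd p @ zs))"
proof -
  have "act_word G (nf_word G p q) x =
      Option.bind (act_word G (Vertex (pran G q) # map Ghost (rev (snd q))) x)
        (act_word G (map Edge (snd p)))"
    using assms(3) by (simp add: nf_word_def act_word_append)
  moreover have "act_word G (map Edge (snd p)) (pran G q, zs) = Some (fst p, snd p @ zs)" for zs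
    using act_edges[of "fst p" "snd p" zs] assms by simp
  moreover note act_ghosts[of "fst q" "snd q"]
  ultimately show ?thesis using assms
    by (auto simp: Option.bind_eq_Some_conv simp del: act_word.simps)
qed

text \<open>Zero acts as the nowhere defined map, while \<open>p q*\<close> sends \<open>q\<close>
  to \<open>p\<close>.\<close>

lemma gnf_nonzero:
  assumes "p \<in> Path G" "q \<in> Path G" "pran G p = pran G q"
  shows "gnf G p q \<noteq> gis_zero G"
proof
  assume "gnf G p q = gis_zero G"
  then have "act_word0 G (Some (nf_word G p q)) = act_word0 G None"
    unfolding gnf_def gis_zero_def using nf_word_closed assms by (intro gis_cls_act) auto
  then have "act_word G (nf_word G p q) q = None" by (metis act_word0.simps)
  moreover have "act_word G (nf_word G p q) q = Some p"
    unfolding act_nf_word[OF assms] by (cases p; cases q) auto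
  ultimately show False by simp
qed

text \<open>If both elements act alike, each is defined at the other's \<open>q\<close>. Hence
  \<open>q\<close> and \<open>q'\<close> extend each other and agree, and \<open>p\<close>,
  \<open>p'\<close> are the images of this common path.\<close>

lemma gnf_inject:
  assumes "p \<in> Path G" "q \<in> Path G" "pran G p = pran G q"
    and "p' \<in> Path G" "q' \<in> Path G" "pran G p' = pran G q'"
    and "gnf G p q = gnf G p' q'"
  shows "p = p' \<and> q = q'"
proof -
  have "act_word0 G (Some (nf_word G p q)) = act_word0 G (Some (nf_word G p' q'))"
    using assms nf_word_closed unfolding gnf_def by (intro gis_cls_act) auto
  then have eq: "act_word G (nf_word G p q) x = act_word G (nf_word G p' q') x" for x
    by (metis act_word0.simps(2))
  have "act_word G (nf_word G p q) q = Some p" "act_word G (nf_word G p' q') q' = Some p'"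
    unfolding act_nf_word[OF assms(1-3)] act_nf_word[OF assms(4-6)]
    by (cases p; cases q; auto) (cases p'; cases q'; auto)
  then have "act_word G (nf_word G p' q') q = Some p" "act_word G (nf_word G p q) q' = Some p'"
    by (simp_all add: eq)
  then show ?thesis
    unfolding act_nf_word[OF assms(1-3)] act_nf_word[OF assms(4-6)]
    by (cases p; cases q; cases p'; cases q') auto
qed


subsection \<open>Paths in the semigroup\<close>

text \<open>For paths with edges, \<open>gpath\<close> omits the vertex that \<open>nf_word\<close>
  carries; the last edge absorbs it.\<close>

lemma gpath_eq: "p \<in> Path G \<Longrightarrow> gpath G p = gnf G p (pran G p, [])"
proof -
  have "gis_cls G (Some (map Edge (e # es))) = gnf G (v, e # es) (pran G (v, e # es), [])"
    if "(v, e # es) \<in> Path G" for v e es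
    using that
  proof (induction es arbitrary: v e)
    case Nil
    then show ?case by (simp add: gnf_Cons_left gnf_Nil)
  next
    case (Cons f es)
    have "set (f # es) \<subseteq> arcs G" using Cons.prems set_Path_subset by fastforce
    then have "gis_cls G (Some (map Edge (e # f # es))) =
        gedge G e \<odot> gis_cls G (Some (map Edge (f # es)))"
      using Cons.prems by (subst gis_mult_cls) auto
    also have "\<dots> = gnf G (v, e # f # es) (pran G (v, e # f # es), [])"
      using Cons pran_in_verts[of "(head G f, es)"] by (simp add: gnf_Cons_left del: gis_mult_cls)
    finally show ?case .
  qed
  then show "p \<in> Path G \<Longrightarrow> gpath G p = gnf G p (pran G p, [])"
    by (cases p; cases "snd p") (auto simp: gpath_def gnf_Nil)
qed

lemma gstar_eq_star: "gstar G p = gis_star (gpath G p)"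
  by (simp add: gstar_def gpath_def rev_map comp_def)

lemma gstar_eq: "p \<in> Path G \<Longrightarrow> gstar G p = gnf G (pran G p, []) p"
  by (simp add: gstar_eq_star gpath_eq gis_star_gnf)

lemma gpath_closed [simp]: "p \<in> Path G \<Longrightarrow> gpath G p \<in> gis G"
  by (simp add: gpath_eq pran_in_verts)

lemma gstar_closed [simp]: "p \<in> Path G \<Longrightarrow> gstar G p \<in> gis G"
  by (simp add: gstar_eq_star)

lemma gpath_gnf:
  assumes "p \<in> Path G" "q \<in> Path G" "r \<in> Path G" "pran G q = pran G r"
  shows "gpath G p \<odot> gnf G q r = (if pran G p = fst q then gnf G (pconc p q) r else gis_zero G)"
proof -
  have "gpath G (v, es) \<odot> gnf G q r =
      (if pran G (v, es) = fst q then gnf G (v, es @ snd q) r else gis_zero G)"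
    if "(v, es) \<in> Path G" for v es
    using that
  proof (induction es arbitrary: v)
    case Nil
    then show ?case using assms by (auto simp: gpath_def gvert_gnf)
  next
    case (Cons e es)
    let ?z = "(pran G (head G e, es), [])"
    have z: "?z \<in> Path G" using Cons.prems pran_in_verts[of "(head G e, es)"] by simp
    have "gpath G (v, e # es) \<odot> gnf G q r = gedge G e \<odot> (gpath G (head G e, es) \<odot> gnf G q r)"
      using Cons.prems assms z by (simp add: gpath_eq gnf_Cons_left gis_mult_assoc)
    moreover have "(head G e, es @ snd q) \<in> Path G" if "pran G (head G e, es) = fst q"
      using that Cons.prems assms(2) by (simp add: Path_append)
    ultimately show ?case using Cons assms by (auto simp: gnf_Cons_left)
  qed
  then show ?thesis using assms(1) by (cases p) (simp add: pconc_def)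
qed

lemma pconc_Path:
  assumes "p \<in> Path G" "q \<in> Path G" "pran G p = fst q"
  shows "pconc p q \<in> Path G" "pran G (pconc p q) = pran G q"
  using assms by (cases p; cases q; simp add: pconc_def Path_append pran_append)+

lemma gnf_gstar:
  assumes "p \<in> Path G" "q \<in> Path G" "r \<in> Path G" "pran G q = pran G r"
  shows "gnf G r q \<odot> gstar G p = (if pran G p = fst q then gnf G r (pconc p q) else gis_zero G)"
proof -
  have "gnf G r q \<odot> gstar G p = gis_star (gpath G p \<odot> gnf G q r)"
    using assms by (simp add: gis_star_mult gstar_eq_star gis_star_gnf)
  then show ?thesis using assms by (auto simp: gpath_gnf gis_star_gnf pconc_Path)
qed

lemma gpath_gstar:
  assumes "p \<in> Path G" "q \<in> Path G" "pran G p = pran G q"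
  shows "gpath G p \<odot> gstar G q = gnf G p q"
  using assms pran_in_verts[of q] by (simp add: gstar_eq gpath_gnf) (simp add: pconc_def)

lemma gpath_gpath:
  assumes "p \<in> Path G" "q \<in> Path G" "pran G p = psrc q"
  shows "gpath G p \<odot> gpath G q = gpath G (pconc p q)"
  using assms pran_in_verts[of q] gpath_gnf[of p q "(pran G q, [])"]
  by (simp add: psrc_def gpath_eq pconc_Path)

text \<open>The innermost factor \<open>e* e\<close> collapses to the range of \<open>e\<close>, so
  \<open>p\<close> cancels one edge at a time. With \<open>q\<close> and \<open>r\<close> trivial
  this shows that \<open>p* p\<close> is the range of \<open>p\<close>.\<close>

lemma gstar_gnf:
  assumes "p \<in> Path G" "q \<in> Path G" "r \<in> Path G" "pran G q = pran G r" "pran G p = fst q"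
  shows "gstar G p \<odot> gnf G (pconc p q) r = gnf G q r"
proof -
  have "gstar G (v, es) \<odot> gnf G (v, es @ snd q) r = gnf G q r"
    if "(v, es) \<in> Path G" "pran G (v, es) = fst q" for v es
    using that
  proof (induction es arbitrary: v)
    case Nil
    then show ?case using assms by (simp add: gstar_def gvert_gnf)
  next
    case (Cons e es)
    let ?z = "(pran G (head G e, es), [])"
    have z: "?z \<in> Path G" using Cons.prems pran_in_verts[of "(head G e, es)"] by simp
    have P: "(head G e, es @ snd q) \<in> Path G" and R: "pran G (head G e, es @ snd q) = pran G r"
      using Cons.prems assms by (auto simp: Path_append pran_append)
    have "gstar G (v, e # es) \<odot> gnf G (v, e # es @ snd q) r =
        gstar G (head G e, es) \<odot> (gghost G e \<odot> gnf G (v, e # es @ snd q) r)"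
      using Cons.prems assms z P by (simp add: gstar_eq gnf_Cons_right gis_mult_assoc)
    then show ?case using Cons assms P R gghost_gnf_Cons[of e v e "es @ snd q" r] by simp
  qed
  then show ?thesis using assms by (cases p) (simp add: pconc_def)
qed

text \<open>A nonzero product has a normal form \<open>r s*\<close>, whose action is defined at
  \<open>s\<close>. There the action of \<open>p\<close> followed by that of \<open>q*\<close> is
  defined too, so some extension of \<open>p\<close> is also an extension of \<open>q\<close>, and
  two prefixes of one list are comparable.\<close>

lemma gstar_gpath_nonzero:
  assumes p: "p \<in> Path G" and q: "q \<in> Path G" and nz: "gstar G q \<odot> gpath G p \<noteq> gis_zero G"
  shows "fst p = fst q \<and> (\<exists>zs. snd p = snd q @ zs \<or> snd q = snd p @ zs)"
proof -
  let ?p = "nf_word G p (pran G p, [])" and ?q = "nf_word G (pran G q, []) q"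
  have cl: "Some ?p \<in> words0 G" "Some ?q \<in> words0 G"
    using p q by (auto intro!: nf_word_closed pran_in_verts simp del: words0_Some)
  have eq: "gstar G q \<odot> gpath G p = gis_cls G (Some (?q @ ?p))"
    using p q gis_mult_cls[OF cl(2,1)] by (simp add: gstar_eq gpath_eq gnf_def)
  obtain r s where rs: "r \<in> Path G" "s \<in> Path G" "pran G r = pran G s"
    and "gstar G q \<odot> gpath G p = gnf G r s"
    by (rule gnf_cases[of "gstar G q \<odot> gpath G p"]) (use p q nz in simp_all)
  then have "gis_cls G (Some (?q @ ?p)) = gis_cls G (Some (nf_word G r s))"
    by (simp add: eq gnf_def)
  then have "act_word0 G (Some (?q @ ?p)) = act_word0 G (Some (nf_word G r s))"
    using cl nf_word_closed rs by (intro gis_cls_act) auto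
  then have "act_word G (?q @ ?p) s = act_word G (nf_word G r s) s"
    by (metis act_word0.simps(2))
  also have "\<dots> = Some r" unfolding act_nf_word[OF rs] by (cases r; cases s) auto
  finally obtain y where "act_word G ?p s = Some y" "act_word G ?q y = Some r"
    by (auto simp: act_word_append Option.bind_eq_Some_conv)
  then obtain us zs where "fst p = fst q" "snd p @ us = snd q @ zs"
    using p q pran_in_verts by (auto simp: act_nf_word)
  then show ?thesis by (metis append_eq_append_conv2)
qed

end


section \<open>Traces on the graph inverse semigroup\<close>

definition (in wf_digraph) gis_trace :: "(('a, 'b) gis \<Rightarrow> 'r::zero) \<Rightarrow> bool" where
  "gis_trace \<delta> \<longleftrightarrow> \<delta> (gis_zero G) = 0 \<and>
     (\<forall>x\<in>gis G. \<forall>y\<in>gis G. \<delta> (gis_mult G x y) = \<delta> (gis_mult G y x))"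

text \<open>Condition (4) is kept apart: the conditions collected here describe the traces before
  the vertex relations are imposed.\<close>

definition (in wf_digraph) path_conditions :: "(('a, 'b) gis \<Rightarrow> 'r::zero) \<Rightarrow> bool" where
  "path_conditions \<delta> \<longleftrightarrow> \<delta> (gis_zero G) = 0 \<and>
     (\<forall>x\<in>gis G. \<delta> x \<noteq> 0 \<longrightarrow>
        (\<exists>p\<in>Path G. \<exists>q\<in>ClPath G.
           x = gis_mult G (gis_mult G (gpath G p) (gpath G q)) (gstar G p) \<or>
           x = gis_mult G (gis_mult G (gpath G p) (gstar G q)) (gstar G p))) \<and>
     (\<forall>p\<in>Path G. \<forall>q\<in>ClPath G. pran G p = psrc q \<longrightarrow>
        \<delta> (gis_mult G (gis_mult G (gpath G p) (gpath G q)) (gstar G p)) = \<delta> (gpath G q) \<and>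
        \<delta> (gis_mult G (gis_mult G (gpath G p) (gstar G q)) (gstar G p)) = \<delta> (gstar G q)) \<and>
     (\<forall>p\<in>ClPath G. \<forall>q\<in>ClPath G. path_approx G p q \<longrightarrow>
        \<delta> (gpath G p) = \<delta> (gpath G q) \<and> \<delta> (gstar G p) = \<delta> (gstar G q))"

context wf_digraph
begin

section \<open>Normal forms of conjugates and of right multiples\<close>

declare gis_mult_cls [simp del]

lemma pconc_Nil [simp]: "pconc p (v, []) = p"
  by (simp add: pconc_def)

lemma ClPath_iff: "z \<in> ClPath G \<longleftrightarrow> z \<in> Path G \<and> pran G z = fst z"
  by (auto simp: ClPath_def psrc_def)

text \<open>Condition (1) does not ask the range of \<open>p\<close> to be the source of the closed
  path. A mismatch makes the product zero, and the case distinction keeps track of this.\<close>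

lemma gpath_gpath_gstar:
  assumes "p \<in> Path G" "z \<in> ClPath G"
  shows "gpath G p \<odot> gpath G z \<odot> gstar G p =
    (if pran G p = psrc z then gnf G (pconc p z) p else gis_zero G)"
proof -
  have z: "z \<in> Path G" "pran G z = fst z" using assms(2) by (auto simp: ClPath_iff)
  then have v: "fst z \<in> verts G" by (simp add: psrc_in_verts)
  have "gpath G p \<odot> gpath G z = (if pran G p = fst z then gnf G (pconc p z) (fst z, []) else gis_zero G)"
    using gpath_gnf[of p z "(fst z, [])"] assms(1) z v by (simp add: gpath_eq[OF z(1)])
  moreover have "gnf G (pconc p z) (fst z, []) \<odot> gstar G p = gnf G (pconc p z) p"
    if "pran G p = fst z"
    using gnf_gstar[of p "(fst z, [])" "pconc p z"] pconc_Path[OF assms(1) z(1) that] assms(1) z v that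
    by simp
  ultimately show ?thesis using assms(1) by (simp add: psrc_def)
qed

lemma gpath_gstar_gstar:
  assumes "p \<in> Path G" "z \<in> ClPath G"
  shows "gpath G p \<odot> gstar G z \<odot> gstar G p =
    (if pran G p = psrc z then gnf G p (pconc p z) else gis_zero G)"
proof -
  have z: "z \<in> Path G" "pran G z = fst z" using assms(2) by (auto simp: ClPath_iff)
  then have v: "fst z \<in> verts G" by (simp add: psrc_in_verts)
  have "gpath G p \<odot> gstar G z = (if pran G p = fst z then gnf G p z else gis_zero G)"
    using gpath_gnf[of p "(fst z, [])" z] assms(1) z v by (simp add: gstar_eq[OF z(1)])
  moreover have "gnf G p z \<odot> gstar G p = gnf G p (pconc p z)" if "pran G p = fst z"
    using gnf_gstar[of p z p] assms(1) z that by simp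
  ultimately show ?thesis using assms(1) by (simp add: psrc_def)
qed

lemma gis_star_gpath [simp]: "gis_star (gpath G p) = gstar G p"
  by (simp add: gstar_eq_star)

lemma gis_star_gstar [simp]: "gis_star (gstar G p) = gpath G p"
  by (simp add: gstar_eq_star del: gis_star_gpath)

lemma gis_star_gedge [simp]: "gis_star (gedge G e) = gghost G e"
  by simp

lemma gis_star_gghost [simp]: "gis_star (gghost G e) = gedge G e"
  by simp

lemma gnf_gvert:
  assumes "v \<in> verts G" "p \<in> Path G" "q \<in> Path G" "pran G p = pran G q"
  shows "gnf G p q \<odot> gvert G v = (if v = fst q then gnf G p q else gis_zero G)"
proof -
  have "gnf G p q \<odot> gvert G v = gis_star (gvert G v \<odot> gnf G q p)"
    using assms by (simp add: gis_star_mult gis_star_gnf)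
  then show ?thesis using assms by (simp add: gvert_gnf gis_star_gnf)
qed

text \<open>The involution turns right multiplication by an edge into left multiplication by its
  ghost, which is already computed.\<close>

lemma gnf_gedge:
  assumes "e \<in> arcs G" "p \<in> Path G" "q \<in> Path G" "pran G p = pran G q"
  shows "gnf G p q \<odot> gedge G e =
    (case snd q of
       [] \<Rightarrow> if pran G p = tail G e then gnf G (fst p, snd p @ [e]) (head G e, []) else gis_zero G
     | f # fs \<Rightarrow> if e = f then gnf G p (head G f, fs) else gis_zero G)"
proof -
  have "gnf G p q \<odot> gedge G e = gis_star (gghost G e \<odot> gnf G q p)"
    using assms by (simp add: gis_star_mult gis_star_gnf del: gis_star_cls)
  moreover obtain v es where q: "q = (v, es)" by (cases q)
  moreover have "gis_star (gghost G e \<odot> gnf G (v, es) p) = (case es of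
       [] \<Rightarrow> if pran G p = tail G e then gnf G (fst p, snd p @ [e]) (head G e, []) else gis_zero G
     | f # fs \<Rightarrow> if e = f then gnf G p (head G f, fs) else gis_zero G)"
  proof (cases es)
    case Nil
    then have v: "pran G p = v" using assms q by simp
    have "pran G (fst p, snd p @ [e]) = head G e" by (simp add: pran_append)
    then show ?thesis
      using Nil assms q v gghost_gnf_Nil[of e p] gghost_gnf_Nil_other[of e p v]
      by (cases "v = tail G e") (auto simp: gis_star_gnf)
  next
    case (Cons f fs)
    then show ?thesis using assms q gghost_gnf_Cons[of e v f fs p] by (auto simp: gis_star_gnf)
  qed
  ultimately show ?thesis by simp
qed

lemma gis_trace_imp_path_conditions:
  assumes "gis_trace \<delta>"
  shows "path_conditions \<delta>"
proof -
  have zero: "\<delta> (gis_zero G) = 0"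
    and comm: "\<And>x y. x \<in> gis G \<Longrightarrow> y \<in> gis G \<Longrightarrow> \<delta> (x \<odot> y) = \<delta> (y \<odot> x)"
    using assms by (auto simp: gis_trace_def)
  show ?thesis
    unfolding path_conditions_def
  proof (intro conjI ballI impI)
    fix x assume x: "x \<in> gis G" "\<delta> x \<noteq> 0"
    then obtain p q where p: "p \<in> Path G" and q: "q \<in> Path G" and pq: "pran G p = pran G q"
      and xpq: "x = gnf G p q"
      using gnf_cases[of x] zero by metis
    have "x = gpath G p \<odot> gstar G q" using p q pq by (simp add: xpq gpath_gstar)
    then have "\<delta> (gstar G q \<odot> gpath G p) \<noteq> 0" using x p q by (simp add: comm)
    then have "gstar G q \<odot> gpath G p \<noteq> gis_zero G" using zero by metis
    from gstar_gpath_nonzero[OF p q this]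
    obtain zs where "fst p = fst q" "snd p = snd q @ zs \<or> snd q = snd p @ zs" by blast
    then consider "p = pconc q (pran G q, zs)" | "q = pconc p (pran G p, zs)"
      by (cases p; cases q) (auto simp: pconc_def)
    then show "\<exists>p\<in>Path G. \<exists>q\<in>ClPath G.
        x = gpath G p \<odot> gpath G q \<odot> gstar G p \<or> x = gpath G p \<odot> gstar G q \<odot> gstar G p"
    proof cases
      case 1
      \<comment> \<open>The remainder \<open>zs\<close> leads from the range of \<open>q\<close> to
        the range of \<open>p\<close>. These agree, so it is closed.\<close>
      have "(pran G q, zs) \<in> ClPath G"
        using 1 p pq Path_append[of "fst q" "snd q" zs] pran_append[of G "fst q" "snd q" zs]
        by (auto simp: pconc_def ClPath_iff)
      moreover from this have "x = gpath G q \<odot> gpath G (pran G q, zs) \<odot> gstar G q"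
        using q 1 by (simp add: gpath_gpath_gstar xpq psrc_def)
      ultimately show ?thesis using q by blast
    next
      case 2
      have "(pran G p, zs) \<in> ClPath G"
        using 2 q pq[symmetric] Path_append[of "fst p" "snd p" zs] pran_append[of G "fst p" "snd p" zs]
        by (auto simp: pconc_def ClPath_iff)
      moreover from this have "x = gpath G p \<odot> gstar G (pran G p, zs) \<odot> gstar G p"
        using p 2 by (simp add: gpath_gstar_gstar xpq psrc_def)
      ultimately show ?thesis using p by blast
    qed
  next
    fix p z assume p: "p \<in> Path G" and z: "z \<in> ClPath G" and pz: "pran G p = psrc z"
    have zP: "z \<in> Path G" and zc: "pran G z = fst z" using z by (auto simp: ClPath_iff)
    have pz': "pran G p = fst z" using pz by (simp add: psrc_def)
    have v: "fst z \<in> verts G" using zP by (rule psrc_in_verts)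
    \<comment> \<open>When the trace property carries \<open>p\<close> to the right end of
      \<open>p z p*\<close>, the factor \<open>p* p\<close> appears; it is the base vertex of
      \<open>z\<close>.\<close>
    have absorb: "gstar G p \<odot> gpath G p = gvert G (fst z)"
      using gstar_gnf[of p "(fst z, [])" "(fst z, [])"] p pz' v by (simp add: gpath_eq gnf_Nil)
    have "\<delta> (gpath G p \<odot> (gpath G z \<odot> gstar G p)) = \<delta> (gpath G z \<odot> (gstar G p \<odot> gpath G p))"
      using p zP by (simp add: comm[of "gpath G p"] gis_mult_assoc)
    also have "gpath G z \<odot> (gstar G p \<odot> gpath G p) = gpath G z"
      using zP v zc by (simp add: absorb gpath_eq gnf_gvert)
    finally show "\<delta> (gpath G p \<odot> gpath G z \<odot> gstar G p) = \<delta> (gpath G z)"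
      using p zP by (simp add: gis_mult_assoc)
    have "\<delta> (gpath G p \<odot> (gstar G z \<odot> gstar G p)) = \<delta> (gstar G z \<odot> (gstar G p \<odot> gpath G p))"
      using p zP by (simp add: comm[of "gpath G p"] gis_mult_assoc)
    also have "gstar G z \<odot> (gstar G p \<odot> gpath G p) = gstar G z"
      using zP v zc by (simp add: absorb gstar_eq gnf_gvert)
    finally show "\<delta> (gpath G p \<odot> gstar G z \<odot> gstar G p) = \<delta> (gstar G z)"
      using p zP by (simp add: gis_mult_assoc)
  next
    fix p q assume "path_approx G p q"
    then obtain x y where xy: "x \<in> Path G" "y \<in> Path G" "pran G x = psrc y" "pran G y = psrc x"
      and p: "p = pconc x y" and q: "q = pconc y x"
      unfolding path_approx_def by blast
    have *: "gpath G p = gpath G x \<odot> gpath G y" "gpath G q = gpath G y \<odot> gpath G x"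
      using xy by (simp_all add: p q gpath_gpath)
    show "\<delta> (gpath G p) = \<delta> (gpath G q)" using xy by (simp add: * comm)
    show "\<delta> (gstar G p) = \<delta> (gstar G q)"
      using xy by (simp add: gstar_eq_star * gis_star_mult comm del: gis_star_gpath)
  qed (rule zero)
qed

section \<open>From the path conditions to the trace property\<close>

lemma path_conditions_zero: "path_conditions \<delta> \<Longrightarrow> \<delta> (gis_zero G) = 0"
  by (simp add: path_conditions_def)

text \<open>Uniqueness of normal forms turns the equation of condition (1) between semigroup
  elements into equations between paths, and \<open>p q*\<close> being nonzero forces
  \<open>r\<close> and \<open>z\<close> to be composable.\<close>

lemma path_conditions_support:
  assumes \<delta>: "path_conditions \<delta>" and p: "p \<in> Path G" and q: "q \<in> Path G"
    and pq: "pran G p = pran G q" and nz: "\<delta> (gnf G p q) \<noteq> 0"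
  obtains r z where "r \<in> Path G" "z \<in> ClPath G" "pran G r = psrc z"
    "p = pconc r z \<and> q = r \<or> p = r \<and> q = pconc r z"
proof -
  obtain r z where r: "r \<in> Path G" and z: "z \<in> ClPath G"
    and eq: "gnf G p q = gpath G r \<odot> gpath G z \<odot> gstar G r \<or>
      gnf G p q = gpath G r \<odot> gstar G z \<odot> gstar G r"
    using \<delta> nz p q unfolding path_conditions_def by (metis gnf_closed)
  have rz: "pran G r = psrc z"
    using eq gnf_nonzero[OF p q pq] r z
    by (auto simp: gpath_gpath_gstar gpath_gstar_gstar split: if_splits)
  have zc: "z \<in> Path G" "pran G z = fst z" using z by (auto simp: ClPath_iff)
  have rzP: "pconc r z \<in> Path G" "pran G (pconc r z) = pran G r"
    using r zc rz pconc_Path[of r z] by (auto simp: psrc_def)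
  have "gnf G p q = gnf G (pconc r z) r \<or> gnf G p q = gnf G r (pconc r z)"
    using eq r z rz by (simp add: gpath_gpath_gstar gpath_gstar_gstar)
  then have "p = pconc r z \<and> q = r \<or> p = r \<and> q = pconc r z"
    using gnf_inject[OF p q pq rzP(1) r rzP(2)]
      gnf_inject[OF p q pq r rzP(1) rzP(2)[symmetric]] by blast
  with r z rz show thesis by (rule that)
qed

text \<open>On the support of \<open>\<delta>\<close> one of the two paths extends the other, so
  their sources agree.\<close>

lemma path_conditions_source_neq:
  assumes "path_conditions \<delta>" "p \<in> Path G" "q \<in> Path G" "pran G p = pran G q" "fst p \<noteq> fst q"
  shows "\<delta> (gnf G p q) = 0"
proof (rule ccontr)
  assume "\<delta> (gnf G p q) \<noteq> 0"
  with assms(1-4) show False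
    by (rule path_conditions_support) (use assms(5) in \<open>auto simp: pconc_def\<close>)
qed

lemma path_conditions_conj:
  assumes "path_conditions \<delta>" "r \<in> Path G" "z \<in> ClPath G" "pran G r = psrc z"
  shows "\<delta> (gnf G (pconc r z) r) = \<delta> (gpath G z)" "\<delta> (gnf G r (pconc r z)) = \<delta> (gstar G z)"
proof -
  have "\<delta> (gpath G r \<odot> gpath G z \<odot> gstar G r) = \<delta> (gpath G z) \<and>
      \<delta> (gpath G r \<odot> gstar G z \<odot> gstar G r) = \<delta> (gstar G z)"
    using assms unfolding path_conditions_def by blast
  then show "\<delta> (gnf G (pconc r z) r) = \<delta> (gpath G z)" "\<delta> (gnf G r (pconc r z)) = \<delta> (gstar G z)"
    using assms(2-4) by (simp_all add: gpath_gpath_gstar gpath_gstar_gstar)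
qed

text \<open>Every condition treats \<open>q\<close> and \<open>q*\<close> alike, so composing with
  the involution only exchanges its two halves. This carries statements about edges over to
  ghosts.\<close>

lemma path_conditions_star:
  assumes \<delta>: "path_conditions \<delta>"
  shows "path_conditions (\<lambda>x. \<delta> (gis_star x))"
proof -
  have star: "gis_star (gpath G p \<odot> gpath G z \<odot> gstar G p) = gpath G p \<odot> gstar G z \<odot> gstar G p"
    "gis_star (gpath G p \<odot> gstar G z \<odot> gstar G p) = gpath G p \<odot> gpath G z \<odot> gstar G p"
    if "p \<in> Path G" "z \<in> ClPath G" for p z
    using that by (simp_all add: ClPath_iff gis_star_mult gis_mult_assoc)
  show ?thesis
    unfolding path_conditions_def
  proof (intro conjI ballI impI)
    fix x assume "x \<in> gis G" "\<delta> (gis_star x) \<noteq> 0"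
    then obtain p z where pz: "p \<in> Path G" "z \<in> ClPath G"
      and "gis_star x = gpath G p \<odot> gpath G z \<odot> gstar G p \<or>
        gis_star x = gpath G p \<odot> gstar G z \<odot> gstar G p"
      using \<delta> unfolding path_conditions_def by (metis gis_star_closed)
    then have "x = gpath G p \<odot> gpath G z \<odot> gstar G p \<or> x = gpath G p \<odot> gstar G z \<odot> gstar G p"
      using star[OF pz] by (metis gis_star_star)
    then show "\<exists>p\<in>Path G. \<exists>q\<in>ClPath G.
        x = gpath G p \<odot> gpath G q \<odot> gstar G p \<or> x = gpath G p \<odot> gstar G q \<odot> gstar G p"
      using pz by blast
  next
    fix p q assume "p \<in> ClPath G" "q \<in> ClPath G" "path_approx G p q"
    then have "\<delta> (gpath G p) = \<delta> (gpath G q) \<and> \<delta> (gstar G p) = \<delta> (gstar G q)"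
      using \<delta> unfolding path_conditions_def by blast
    then show "\<delta> (gis_star (gpath G p)) = \<delta> (gis_star (gpath G q))"
      "\<delta> (gis_star (gstar G p)) = \<delta> (gis_star (gstar G q))" by simp_all
  next
    fix p q assume pq: "p \<in> Path G" "q \<in> ClPath G" "pran G p = psrc q"
    then have "\<delta> (gpath G p \<odot> gpath G q \<odot> gstar G p) = \<delta> (gpath G q) \<and>
        \<delta> (gpath G p \<odot> gstar G q \<odot> gstar G p) = \<delta> (gstar G q)"
      using \<delta> unfolding path_conditions_def by blast
    then show "\<delta> (gis_star (gpath G p \<odot> gpath G q \<odot> gstar G p)) = \<delta> (gis_star (gpath G q))"
      "\<delta> (gis_star (gpath G p \<odot> gstar G q \<odot> gstar G p)) = \<delta> (gis_star (gstar G q))"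
      using pq by (simp_all add: star)
  qed (use path_conditions_zero[OF \<delta>] in simp)
qed

text \<open>If either value is nonzero, both elements are conjugates of one closed path
  \<open>z\<close>, or of \<open>z*\<close>, by paths that differ only in the first edge
  \<open>e\<close>; condition (2) gives them the same value. Otherwise both values are zero.\<close>

lemma path_conditions_shift:
  assumes \<delta>: "path_conditions \<delta>" and p: "(v, e # es) \<in> Path G" and q: "(v, e # fs) \<in> Path G"
    and pq: "pran G (v, e # es) = pran G (v, e # fs)"
  shows "\<delta> (gnf G (head G e, es) (head G e, fs)) = \<delta> (gnf G (v, e # es) (v, e # fs))"
proof -
  have shift: ?thesis
    if r: "(head G e, rs) \<in> Path G" and z: "z \<in> ClPath G" and rz: "pran G (head G e, rs) = psrc z"
      and eq: "es = rs @ snd z \<and> fs = rs \<or> es = rs \<and> fs = rs @ snd z" for rs z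
  proof -
    have r': "(v, e # rs) \<in> Path G" and rz': "pran G (v, e # rs) = psrc z" using r rz p by auto
    show ?thesis
      using eq path_conditions_conj[OF \<delta> r z rz] path_conditions_conj[OF \<delta> r' z rz']
      by (auto simp: pconc_def)
  qed
  consider "\<delta> (gnf G (head G e, es) (head G e, fs)) \<noteq> 0" | "\<delta> (gnf G (v, e # es) (v, e # fs)) \<noteq> 0"
    | "\<delta> (gnf G (head G e, es) (head G e, fs)) = 0" "\<delta> (gnf G (v, e # es) (v, e # fs)) = 0"
    by blast
  then show ?thesis
  proof cases
    case 1
    obtain r z where "r \<in> Path G" "z \<in> ClPath G" "pran G r = psrc z"
      "(head G e, es) = pconc r z \<and> (head G e, fs) = r \<or>
       (head G e, es) = r \<and> (head G e, fs) = pconc r z"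
      by (rule path_conditions_support[OF \<delta> _ _ _ 1]) (use p q pq in auto)
    then show ?thesis using shift[of "snd r" z] by (cases r) (auto simp: pconc_def)
  next
    case 2
    obtain r z where "r \<in> Path G" "z \<in> ClPath G" "pran G r = psrc z"
      "(v, e # es) = pconc r z \<and> (v, e # fs) = r \<or> (v, e # es) = r \<and> (v, e # fs) = pconc r z"
      by (rule path_conditions_support[OF \<delta> p q pq 2])
    \<comment> \<open>Here \<open>r\<close> is one of the two given paths, so it begins with
      \<open>e\<close>, and \<open>tl\<close> removes exactly this edge.\<close>
    then show ?thesis using shift[of "tl (snd r)" z] by (cases r) (auto simp: pconc_def)
  qed simp
qed

text \<open>Write \<open>a = p q*\<close>. If \<open>q\<close> is a vertex and both products are
  nonzero, they are the paths \<open>p e\<close> and \<open>e p\<close>, which are closed and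
  rotations of each other, so condition (3) applies. If \<open>q\<close> begins with
  \<open>e\<close> and both are nonzero, \<open>e a\<close> is the conjugate of \<open>a e\<close>
  by \<open>e\<close>, and \<open>path_conditions_shift\<close> applies. If only one product is
  nonzero, it lies outside the support of \<open>\<delta>\<close>.\<close>

lemma path_conditions_edge_commute:
  assumes \<delta>: "path_conditions \<delta>" and e: "e \<in> arcs G" and a: "a \<in> gis G"
  shows "\<delta> (a \<odot> gedge G e) = \<delta> (gedge G e \<odot> a)"
  using a
proof (cases rule: gnf_cases)
  case 1
  then show ?thesis using e by simp
next
  case (2 p q)
  have zero: "\<delta> (gis_zero G) = 0" using \<delta> by (rule path_conditions_zero)
  obtain u es where p: "p = (u, es)" by (cases p)
  obtain v fs where q: "q = (v, fs)" by (cases q)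
  have left: "\<delta> (gedge G e \<odot> a) =
      (if head G e = u then \<delta> (gnf G (tail G e, e # es) (v, fs)) else 0)"
    using gedge_gnf[OF e 2(1-3)] zero by (auto simp: 2(4) p q)
  show ?thesis
  proof (cases fs)
    case Nil
    have pv: "pran G (u, es) = v" using 2(3) by (simp add: p q Nil)
    have right: "\<delta> (a \<odot> gedge G e) =
        (if v = tail G e then \<delta> (gnf G (u, es @ [e]) (head G e, [])) else 0)"
      using gnf_gedge[OF e 2(1-3)] zero by (auto simp: 2(4) p q Nil pv)
    have pe: "(u, es @ [e]) \<in> Path G" "pran G (u, es @ [e]) = head G e" if "v = tail G e"
      using 2(1) e that by (auto simp: p Path_append pran_append pv)
    have ep: "(tail G e, e # es) \<in> Path G" "pran G (tail G e, e # es) = v" if "head G e = u"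
      using 2(1) e that by (auto simp: p pv)
    show ?thesis
    proof (cases "v = tail G e"; cases "head G e = u")
      assume *: "v = tail G e" "head G e = u"
      have "path_approx G (u, es @ [e]) (tail G e, e # es)"
        unfolding path_approx_def
        by (rule bexI[of _ "(u, es)"], rule bexI[of _ "(tail G e, [e])"])
           (use * 2(1) pv e in \<open>auto simp: p pconc_def psrc_def\<close>)
      moreover have "(u, es @ [e]) \<in> ClPath G" "(tail G e, e # es) \<in> ClPath G"
        using * pe ep by (auto simp: ClPath_iff)
      ultimately have "\<delta> (gpath G (u, es @ [e])) = \<delta> (gpath G (tail G e, e # es))"
        using \<delta> unfolding path_conditions_def by blast
      then show ?thesis using pe ep * gpath_eq[of "(u, es @ [e])"] gpath_eq[of "(tail G e, e # es)"]
        by (simp add: left right Nil)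
    next
      assume *: "v = tail G e" "head G e \<noteq> u"
      then show ?thesis using pe e
        by (auto simp: left right intro!: path_conditions_source_neq[OF \<delta>])
    next
      assume *: "v \<noteq> tail G e" "head G e = u"
      have "\<delta> (gnf G (tail G e, e # es) (v, [])) = 0"
        by (rule path_conditions_source_neq[OF \<delta>]) (use ep * 2(2) q Nil in auto)
      then show ?thesis using * by (auto simp: left right Nil)
    qed (simp add: left right)
  next
    case (Cons f gs)
    have right: "\<delta> (a \<odot> gedge G e) = (if e = f then \<delta> (gnf G (u, es) (head G f, gs)) else 0)"
      using gnf_gedge[OF e 2(1-3)] zero by (auto simp: 2(4) p q Cons)
    have qf: "(v, f # gs) \<in> Path G" "pran G (u, es) = pran G (head G f, gs)"
      using 2 by (auto simp: p q Cons)
    show ?thesis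
    proof (cases "e = f"; cases "head G e = u")
      assume *: "e = f" "head G e = u"
      then show ?thesis
        using path_conditions_shift[OF \<delta>, of v e es gs] qf 2(1)
        unfolding left right by (auto simp: p Cons)
    next
      assume *: "e = f" "head G e \<noteq> u"
      then have "\<delta> (gnf G (u, es) (head G f, gs)) = 0"
        by (intro path_conditions_source_neq[OF \<delta>]) (use qf 2(1) p in auto)
      then show ?thesis using * unfolding left right by simp
    next
      assume *: "e \<noteq> f" "head G e = u"
      \<comment> \<open>Two paths with different first edges are not prefixes of each other.\<close>
      have "\<delta> (gnf G (tail G e, e # es) (v, f # gs)) = 0"
      proof (rule ccontr)
        assume nz: "\<delta> (gnf G (tail G e, e # es) (v, f # gs)) \<noteq> 0"
        show False
          by (rule path_conditions_support[OF \<delta> _ _ _ nz])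
             (use * qf e 2(1) p in \<open>auto simp: pconc_def\<close>)
      qed
      then show ?thesis using * unfolding left right Cons by simp
    qed (simp add: left right)
  qed
qed

text \<open>
  The elements that commute with everything under \<open>\<delta>\<close> are closed under multiplication,
  so that it suffices to treat the generators.
\<close>

lemma path_conditions_imp_gis_trace:
  assumes \<delta>: "path_conditions \<delta>"
  shows "gis_trace \<delta>"
proof -
  have "\<forall>x\<in>gis G. \<delta> (x \<odot> y) = \<delta> (y \<odot> x)" if "y \<in> gis G" for y
    using that
  proof (induction rule: gis_induct)
    case (vertex v)
    show ?case
    proof
      fix x assume "x \<in> gis G"
      then show "\<delta> (x \<odot> gvert G v) = \<delta> (gvert G v \<odot> x)"
      proof (cases rule: gnf_cases)
        case (2 p q)
        have "\<delta> (gnf G p q) = 0" if "fst p \<noteq> fst q"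
          using \<delta> 2(1-3) that by (rule path_conditions_source_neq)
        then show ?thesis using 2 vertex path_conditions_zero[OF \<delta>] by (simp add: gvert_gnf gnf_gvert)
      qed (use vertex in simp)
    qed
  next
    case (edge e)
    then show ?case using path_conditions_edge_commute[OF \<delta>] by blast
  next
    case (ghost e)
    show ?case
    proof
      fix x assume x: "x \<in> gis G"
      have "\<delta> (gis_star (gis_star x \<odot> gedge G e)) = \<delta> (gis_star (gedge G e \<odot> gis_star x))"
        using path_conditions_edge_commute[OF path_conditions_star[OF \<delta>] ghost] x by simp
      then show "\<delta> (x \<odot> gghost G e) = \<delta> (gghost G e \<odot> x)"
        using x ghost by (simp add: gis_star_mult del: gis_star_cls)
    qed
  next
    case (mult y z)
    show ?case
    proof
      fix x assume x: "x \<in> gis G"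
      have "\<delta> (x \<odot> (y \<odot> z)) = \<delta> ((x \<odot> y) \<odot> z)" using x mult by (simp add: gis_mult_assoc)
      also have "\<dots> = \<delta> (z \<odot> (x \<odot> y))" using x mult by simp
      also have "\<dots> = \<delta> ((z \<odot> x) \<odot> y)" using x mult by (simp add: gis_mult_assoc)
      also have "\<dots> = \<delta> (y \<odot> (z \<odot> x))" using x mult by simp
      finally show "\<delta> (x \<odot> (y \<odot> z)) = \<delta> ((y \<odot> z) \<odot> x)"
        using x mult by (simp add: gis_mult_assoc)
    qed
  qed simp
  then show ?thesis using path_conditions_zero[OF \<delta>] by (simp add: gis_trace_def)
qed

lemma gis_trace_iff_path_conditions: "gis_trace \<delta> \<longleftrightarrow> path_conditions \<delta>"
  using gis_trace_imp_path_conditions path_conditions_imp_gis_trace by blast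

section \<open>Relations at regular vertices\<close>

lemma gis_trace_edge_ghost:
  assumes "gis_trace \<delta>" "e \<in> arcs G"
  shows "\<delta> (gedge G e \<odot> gghost G e) = \<delta> (gvert G (head G e))"
proof -
  have "\<delta> (gedge G e \<odot> gghost G e) = \<delta> (gghost G e \<odot> gedge G e)"
    using assms unfolding gis_trace_def by (simp del: gghost_gedge)
  then show ?thesis using assms(2) by simp
qed

text \<open>Write \<open>g = p q*\<close> and suppose \<open>g v\<close> is nonzero. If
  \<open>q\<close> has a first edge \<open>f\<close>, then \<open>g e e*\<close> is \<open>g\<close>
  for \<open>e = f\<close> and zero otherwise. If \<open>q\<close> is a vertex and \<open>p\<close>
  begins with \<open>f\<close>, the same is true of \<open>e e* g\<close>, which has the same value
  by the trace property. If both are vertices, then \<open>g = v\<close> and the claim is condition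
  (4), since \<open>e e*\<close> and \<open>e* e\<close> have equal values.\<close>

lemma gis_trace_regular_vertex:
  fixes \<delta> :: "('a, 'b) gis \<Rightarrow> 'r::comm_monoid_add"
  assumes \<delta>: "gis_trace \<delta>" and v: "regular_vertex G v"
    and sum: "\<delta> (gvert G v) = (\<Sum>e\<in>out_arcs G v. \<delta> (gvert G (head G e)))" and g: "g \<in> gis G"
  shows "\<delta> (g \<odot> gvert G v) = (\<Sum>e\<in>out_arcs G v. \<delta> (g \<odot> (gedge G e \<odot> gghost G e)))"
proof -
  have zero: "\<delta> (gis_zero G) = 0"
    and comm: "\<And>x y. x \<in> gis G \<Longrightarrow> y \<in> gis G \<Longrightarrow> \<delta> (x \<odot> y) = \<delta> (y \<odot> x)"
    using \<delta> by (auto simp: gis_trace_def)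
  have vV: "v \<in> verts G" and fin: "finite (out_arcs G v)" using v by (auto simp: regular_vertex_def)
  have eeG: "gedge G e \<odot> gghost G e \<in> gis G" if "e \<in> out_arcs G v" for e
    using that by simp
  have v_ee: "gvert G v \<odot> (gedge G e \<odot> gghost G e) = gedge G e \<odot> gghost G e"
    if "e \<in> out_arcs G v" for e
    using that vV gvert_gedge[of e] by (auto simp: gis_mult_assoc[symmetric])
  \<comment> \<open>Every summand contains \<open>g v\<close> as a factor, because
    \<open>e e* = v e e*\<close>.\<close>
  have zero_case: ?thesis if "g \<odot> gvert G v = gis_zero G"
  proof -
    have "g \<odot> (gedge G e \<odot> gghost G e) = gis_zero G" if e: "e \<in> out_arcs G v" for e
    proof -
      have "g \<odot> (gedge G e \<odot> gghost G e) = (g \<odot> gvert G v) \<odot> (gedge G e \<odot> gghost G e)"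
        using gis_mult_assoc[of g "gvert G v" "gedge G e \<odot> gghost G e"] eeG[OF e] v_ee[OF e] g vV
        by simp
      then show ?thesis using \<open>g \<odot> gvert G v = gis_zero G\<close> eeG[OF e] by simp
    qed
    then show ?thesis using that zero by simp
  qed
  have delta_case: ?thesis
    if "\<And>e. e \<in> out_arcs G v \<Longrightarrow> \<delta> (g \<odot> (gedge G e \<odot> gghost G e)) = (if e = f then \<delta> g else 0)"
      and "g \<odot> gvert G v = g" "f \<in> out_arcs G v" for f
    using that(2,3) fin by (simp add: sum.cong[OF HOL.refl that(1)] del: in_out_arcs_conv)
  from g show ?thesis
  proof (cases rule: gnf_cases)
    case 1
    then show ?thesis using vV zero_case by simp
  next
    case (2 p q)
    obtain u es where p: "p = (u, es)" by (cases p)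
    obtain w fs where q: "q = (w, fs)" by (cases q)
    have gv: "g \<odot> gvert G v = (if v = w then g else gis_zero G)"
      using gnf_gvert[OF vV 2(1-3)] by (simp add: 2(4) q)
    show ?thesis
    proof (cases "v = w")
      case False
      then show ?thesis using zero_case gv by simp
    next
      case w: True
      show ?thesis
      proof (cases fs)
        case (Cons f gs)
        show ?thesis
        proof (rule delta_case)
          show "g \<odot> gvert G v = g" using gv w by simp
          show f: "f \<in> out_arcs G v" using 2(2) by (auto simp: q Cons w)
          fix e assume e: "e \<in> out_arcs G v"
          have "g \<odot> (gedge G e \<odot> gghost G e) = (g \<odot> gedge G e) \<odot> gghost G e"
            using e g by (simp add: gis_mult_assoc)
          also have "g \<odot> gedge G e = (if e = f then gnf G p (head G f, gs) else gis_zero G)"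
            using gnf_gedge[OF _ 2(1-3), of e] e by (simp add: 2(4) q Cons)
          also have "(if e = f then gnf G p (head G f, gs) else gis_zero G) \<odot> gghost G e =
              (if e = f then g else gis_zero G)"
            using gnf_Cons_right[OF 2(1), of w f gs] 2(2) e by (simp add: 2(4) q Cons)
          finally show "\<delta> (g \<odot> (gedge G e \<odot> gghost G e)) = (if e = f then \<delta> g else 0)"
            using zero by simp
        qed
      next
        case fs: Nil
        show ?thesis
        proof (cases es)
          case Nil
          have "g = gvert G v" using 2(3) by (simp add: 2(4) p q fs Nil w gnf_Nil)
          then show ?thesis
            using sum vV v_ee gis_trace_edge_ghost[OF \<delta>] by simp
        next
          case (Cons f gs)
          have f: "f \<in> arcs G" "tail G f = u" "(head G f, gs) \<in> Path G"
              "pran G (head G f, gs) = w" "w \<in> verts G"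
            using 2 by (auto simp: p q Cons fs)
          have g_eq: "g = gnf G (u, f # gs) (w, [])" by (simp add: 2(4) p q Cons fs)
          have ee: "\<delta> (g \<odot> (gedge G e \<odot> gghost G e)) = (if e = f then \<delta> g else 0)"
            if e: "e \<in> out_arcs G v" for e
          proof -
            have "\<delta> (g \<odot> (gedge G e \<odot> gghost G e)) = \<delta> (gedge G e \<odot> (gghost G e \<odot> g))"
              using e g eeG[OF e] by (simp add: comm[of g] gis_mult_assoc)
            also have "gghost G e \<odot> g = (if e = f then gnf G (head G f, gs) (w, []) else gis_zero G)"
              using gghost_gnf_Cons[of e u f gs "(w, [])"] f e by (simp add: g_eq)
            also have "gedge G e \<odot> \<dots> = (if e = f then g else gis_zero G)"
              using gnf_Cons_left[of u f gs "(w, [])"] f e by (simp add: g_eq)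
            finally show ?thesis using zero by simp
          qed
          show ?thesis
          proof (cases "u = v")
            case True
            then show ?thesis using delta_case[OF ee] gv w f by simp
          next
            \<comment> \<open>The first edge \<open>f\<close> of \<open>p\<close> does not leave
              \<open>v\<close>, so no summand survives; the left side vanishes once \<open>v\<close>
              is moved in front of \<open>p\<close>.\<close>
            case False
            have "\<delta> (g \<odot> gvert G v) = \<delta> (gvert G v \<odot> g)" using g vV by (intro comm) auto
            also have "\<dots> = 0"
              using gvert_gnf[OF vV, of "(u, f # gs)" "(w, [])"] f False zero by (simp add: g_eq)
            finally have "\<delta> (g \<odot> gvert G v) = 0" .
            moreover have "\<delta> (g \<odot> (gedge G e \<odot> gghost G e)) = 0" if "e \<in> out_arcs G v" for e
              using ee[OF that] that False f by auto
            ultimately show ?thesis by simp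
          qed
        qed
      qed
    qed
  qed
qed

end


section \<open>Traces on Leavitt path algebras\<close>

context wf_digraph
begin

lemma kalg_laws_gis_alg: "kalg_laws (gis_alg G)"
  unfolding gis_alg_def by (rule kalg_laws_semigroup_alg[OF gis_mult_closed gis_mult_assoc])

lemma gis_alg_carrier [simp]: "acarrier (gis_alg G) = {f. Poly_Mapping.keys f \<subseteq> gis G}"
  by (simp add: gis_alg_def)

lemma zero_ideal_gen_carrier:
  "{Poly_Mapping.single (gis_zero G) 1} \<subseteq> acarrier (gis_alg G)"
  by simp

lemma alg_ideal_zero_ideal: "alg_ideal (gis_alg G) (zero_ideal G)"
  unfolding zero_ideal_def
  by (rule kalg_laws.alg_ideal_gen[OF kalg_laws_gis_alg zero_ideal_gen_carrier])

lemma kalg_laws_contracted_alg: "kalg_laws (contracted_alg G)"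
  unfolding contracted_alg_def
  by (rule kalg_laws.kalg_laws_quot[OF kalg_laws_gis_alg alg_ideal_zero_ideal])

text \<open>A representative in the semigroup algebra of the generator of
  \<open>leavitt_ideal G\<close> at \<open>v\<close>, so that traces can be evaluated before the
  zeros are identified.\<close>

definition vertex_relator :: "'a \<Rightarrow> ('a, 'b) gis \<Rightarrow>\<^sub>0 'k::field" where
  "vertex_relator v = Poly_Mapping.single (gvert G v) 1 -
     (\<Sum>e\<in>out_arcs G v. Poly_Mapping.single (gis_mult G (gedge G e) (gghost G e)) 1)"

lemma vertex_relator_closed:
  assumes "regular_vertex G v"
  shows "Poly_Mapping.keys (vertex_relator v :: _ \<Rightarrow>\<^sub>0 'k::field) \<subseteq> gis G"
  unfolding vertex_relator_def
  by (rule semigroup_alg_diff_sum_closed[OF gis_mult_closed gis_mult_assoc])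
     (use assms in \<open>auto simp: regular_vertex_def\<close>)

abbreviation contr :: "(('a, 'b) gis \<Rightarrow>\<^sub>0 'k::field) \<Rightarrow> (('a, 'b) gis \<Rightarrow>\<^sub>0 'k) set" where
  "contr \<equiv> alg_coset (gis_alg G) (zero_ideal G)"

lemma contracted_alg_carrier: "acarrier (contracted_alg G) = contr ` acarrier (gis_alg G)"
  unfolding contracted_alg_def
  by (rule kalg_laws.quot_carrier[OF kalg_laws_gis_alg alg_ideal_zero_ideal])

lemma leavitt_ideal_eq: "leavitt_ideal G =
    gen_ideal (contracted_alg G) {contr (vertex_relator v) | v. regular_vertex G v}"
  by (simp add: leavitt_ideal_def vertex_relator_def)

lemma leavitt_ideal_gen_carrier:
  "{contr (vertex_relator v) | v. regular_vertex G v} \<subseteq> acarrier (contracted_alg G)"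
  using vertex_relator_closed by (auto simp: contracted_alg_carrier)

text \<open>The zero absorbs every basis element, so all left multiples give the same constraint as
  the generator itself.\<close>

lemma gis_alg_trace_zero_ideal_iff:
  fixes scale :: "'k::field \<Rightarrow> 'r::ring \<Rightarrow> 'r"
  assumes scale: "k_algebra scale" and T: "linear_trace scale (gis_alg G) T"
  shows "(\<forall>x\<in>{Poly_Mapping.single (gis_zero G) 1}.
      T x = 0 \<and> (\<forall>a\<in>acarrier (gis_alg G). T (amult (gis_alg G) a x) = 0)) \<longleftrightarrow>
    T (Poly_Mapping.single (gis_zero G) 1) = 0"
  using semigroup_alg_trace_mult_zero_iff[OF gis_mult_closed gis_mult_assoc scale,
      of T "Poly_Mapping.single (gis_zero G) 1"] T
  by (auto simp: gis_alg_def semigroup_alg_mult_single[OF gis_mult_closed gis_mult_assoc])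

text \<open>Left multiplication by a basis element \<open>g\<close> sends the relator to a
  difference of the same shape, so by linearity each \<open>g\<close> contributes one sum identity
  on the semigroup.\<close>

lemma gis_alg_trace_vertex_relator_iff:
  fixes scale :: "'k::field \<Rightarrow> 'r::ring \<Rightarrow> 'r"
  assumes scale: "k_algebra scale" and T: "linear_trace scale (gis_alg G) T"
    and v: "regular_vertex G v"
  shows "T (vertex_relator v) = 0 \<and>
      (\<forall>a\<in>acarrier (gis_alg G). T (amult (gis_alg G) a (vertex_relator v)) = 0) \<longleftrightarrow>
    T (Poly_Mapping.single (gvert G v) 1) =
      (\<Sum>e\<in>out_arcs G v. T (Poly_Mapping.single (gedge G e \<odot> gghost G e) 1)) \<and>
    (\<forall>g\<in>gis G. T (Poly_Mapping.single (g \<odot> gvert G v) 1) =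
      (\<Sum>e\<in>out_arcs G v. T (Poly_Mapping.single (g \<odot> (gedge G e \<odot> gghost G e)) 1)))"
proof -
  note gis_semigroup = gis_mult_closed gis_mult_assoc
  have vV: "v \<in> verts G" using v by (simp add: regular_vertex_def)
  have T': "linear_trace scale (semigroup_alg (gis G) (gis_mult G)) T"
    using T by (simp add: gis_alg_def)
  have "T (vertex_relator v) = T (Poly_Mapping.single (gvert G v) 1) -
      (\<Sum>e\<in>out_arcs G v. T (Poly_Mapping.single (gedge G e \<odot> gghost G e) 1))"
    unfolding vertex_relator_def
    by (rule semigroup_alg_trace_diff_sum[OF gis_semigroup T']) (use vV in auto)
  moreover have "T (amult (gis_alg G) (Poly_Mapping.single g 1) (vertex_relator v)) =
      T (Poly_Mapping.single (g \<odot> gvert G v) 1) -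
      (\<Sum>e\<in>out_arcs G v. T (Poly_Mapping.single (g \<odot> (gedge G e \<odot> gghost G e)) 1))"
    if "g \<in> gis G" for g
  proof -
    have "amult (gis_alg G) (Poly_Mapping.single g 1) (vertex_relator v) =
        Poly_Mapping.single (g \<odot> gvert G v) 1 -
        (\<Sum>e\<in>out_arcs G v. Poly_Mapping.single (g \<odot> (gedge G e \<odot> gghost G e)) (1::'k))"
      unfolding vertex_relator_def gis_alg_def
      by (simp add: semigroup_alg_mult_diff_sum[OF gis_semigroup]
          semigroup_alg_mult_single[OF gis_semigroup])
    also have "T \<dots> = T (Poly_Mapping.single (g \<odot> gvert G v) 1) -
      (\<Sum>e\<in>out_arcs G v. T (Poly_Mapping.single (g \<odot> (gedge G e \<odot> gghost G e)) 1))"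
      by (rule semigroup_alg_trace_diff_sum[OF gis_semigroup T']) (use vV that in auto)
    finally show ?thesis .
  qed
  moreover have "(\<forall>a\<in>acarrier (gis_alg G). T (amult (gis_alg G) a (vertex_relator v)) = 0) \<longleftrightarrow>
      (\<forall>g\<in>gis G. T (amult (gis_alg G) (Poly_Mapping.single g 1) (vertex_relator v)) = 0)"
    unfolding gis_alg_def
    by (rule semigroup_alg_trace_mult_zero_iff[OF gis_semigroup scale T' vertex_relator_closed[OF v]])
  ultimately show ?thesis by auto
qed

text \<open>The bijections \<open>f3\<close>, \<open>f2\<close>, \<open>f1\<close> descend through
  the stages of the construction. The constraints found at one stage have to be rewritten in terms
  of \<open>\<delta>\<close>; \<open>bij_betw_Collect\<close> then cuts both sides of the remaining
  bijection down accordingly.\<close>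

lemma bij_betw_restrict_to_gis:
  fixes scale :: "'k::field \<Rightarrow> 'r::ring \<Rightarrow> 'r"
  assumes scale: "k_algebra scale"
  shows "bij_betw (restrict_to_gis G)
    {t :: (('a, 'b) gis \<Rightarrow>\<^sub>0 'k) set set \<Rightarrow> 'r. linear_trace scale (leavitt_alg G) t}
    {\<delta> \<in> extensional (gis G). gis_trace \<delta> \<and>
      (\<forall>v. regular_vertex G v \<longrightarrow>
        \<delta> (gvert G v) = (\<Sum>e\<in>out_arcs G v. \<delta> (gedge G e \<odot> gghost G e)) \<and>
        (\<forall>g\<in>gis G. \<delta> (g \<odot> gvert G v) =
          (\<Sum>e\<in>out_arcs G v. \<delta> (g \<odot> (gedge G e \<odot> gghost G e)))))}"
    (is "bij_betw _ ?L ?D")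
proof -
  let ?A = "gis_alg G :: ('k, _) kalg" and ?C = "contracted_alg G :: ('k, _) kalg"
  let ?X = "{contr (vertex_relator v) :: (('a, 'b) gis \<Rightarrow>\<^sub>0 'k) set | v. regular_vertex G v}"
  interpret A: kalg_laws ?A by (rule kalg_laws_gis_alg)
  interpret C: kalg_laws ?C by (rule kalg_laws_contracted_alg)
  define f1 :: "((('a, 'b) gis \<Rightarrow>\<^sub>0 'k) \<Rightarrow> 'r) \<Rightarrow> _"
    where "f1 = (\<lambda>T. \<lambda>g\<in>gis G. T (Poly_Mapping.single g 1))"
  define f2 :: "((('a, 'b) gis \<Rightarrow>\<^sub>0 'k) set \<Rightarrow> 'r) \<Rightarrow> _"
    where "f2 = (\<lambda>t. \<lambda>x\<in>acarrier ?A. t (contr x))"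
  define f3 :: "((('a, 'b) gis \<Rightarrow>\<^sub>0 'k) set set \<Rightarrow> 'r) \<Rightarrow> _"
    where "f3 = (\<lambda>t. \<lambda>x\<in>acarrier ?C. t (alg_coset ?C (leavitt_ideal G) x))"
  define relations where "relations \<delta> \<longleftrightarrow> (\<forall>v. regular_vertex G v \<longrightarrow>
        \<delta> (gvert G v) = (\<Sum>e\<in>out_arcs G v. \<delta> (gedge G e \<odot> gghost G e)) \<and>
        (\<forall>g\<in>gis G. \<delta> (g \<odot> gvert G v) =
          (\<Sum>e\<in>out_arcs G v. \<delta> (g \<odot> (gedge G e \<odot> gghost G e)))))"
    for \<delta> :: "('a, 'b) gis \<Rightarrow> 'r"
  have "bij_betw f1 {T. linear_trace scale ?A T}
      {\<delta> \<in> extensional (gis G). \<forall>a\<in>gis G. \<forall>b\<in>gis G. \<delta> (a \<odot> b) = \<delta> (b \<odot> a)}"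
    unfolding f1_def gis_alg_def
    by (rule bij_betw_traces_semigroup_alg[OF gis_mult_closed gis_mult_assoc scale])
  then have f1: "bij_betw f1
      {T \<in> {T. linear_trace scale ?A T}. \<forall>x\<in>{Poly_Mapping.single (gis_zero G) 1}.
        T x = 0 \<and> (\<forall>a\<in>acarrier ?A. T (amult ?A a x) = 0)}
      {\<delta> \<in> {\<delta> \<in> extensional (gis G). \<forall>a\<in>gis G. \<forall>b\<in>gis G. \<delta> (a \<odot> b) = \<delta> (b \<odot> a)}.
        \<delta> (gis_zero G) = 0}"
    by (rule bij_betw_Collect)
       (unfold mem_Collect_eq, subst gis_alg_trace_zero_ideal_iff[OF scale], simp_all add: f1_def)
  have f2: "bij_betw f2 {t. linear_trace scale ?C t}
      {T \<in> {T. linear_trace scale ?A T}. \<forall>x\<in>{Poly_Mapping.single (gis_zero G) 1}.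
        T x = 0 \<and> (\<forall>a\<in>acarrier ?A. T (amult ?A a x) = 0)}"
    using A.bij_betw_traces_quot[OF scale zero_ideal_gen_carrier]
    by (simp add: f2_def contracted_alg_def zero_ideal_def)
  \<comment> \<open>The constraints on \<open>t\<close> concern cosets. Each coset has a
    representative, so they amount to the same constraints on \<open>f2 t\<close> in the semigroup
    algebra, where \<open>gis_alg_trace_vertex_relator_iff\<close> evaluates them.\<close>
  have rel: "relations ((f1 \<circ> f2) t) \<longleftrightarrow>
      (\<forall>x\<in>?X. t x = 0 \<and> (\<forall>a\<in>acarrier ?C. t (amult ?C a x) = 0))"
    if t: "linear_trace scale ?C t" for t
  proof -
    have T: "linear_trace scale ?A (f2 t)" using bij_betw_apply[OF f2, of t] t by simp
    have "(t (contr (vertex_relator v)) = 0 \<and>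
          (\<forall>a\<in>acarrier ?C. t (amult ?C a (contr (vertex_relator v))) = 0)) \<longleftrightarrow>
        (f2 t (vertex_relator v) = 0 \<and>
          (\<forall>a\<in>acarrier ?A. f2 t (amult ?A a (vertex_relator v)) = 0))"
      if v: "regular_vertex G v" for v
    proof -
      have "amult ?C (contr a) (contr (vertex_relator v)) = contr (amult ?A a (vertex_relator v))"
        if "a \<in> acarrier ?A" for a
        unfolding contracted_alg_def
        by (rule A.quot_mult[OF alg_ideal_zero_ideal]) (use that vertex_relator_closed[OF v] in simp_all)
      moreover have "vertex_relator v \<in> acarrier ?A" using vertex_relator_closed[OF v] by simp
      moreover note A.mult_closed
      ultimately show ?thesis unfolding contracted_alg_carrier f2_def
        by (simp del: gis_alg_carrier)
    qed
    moreover have "(f2 t (vertex_relator v) = 0 \<and>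
          (\<forall>a\<in>acarrier ?A. f2 t (amult ?A a (vertex_relator v)) = 0)) \<longleftrightarrow>
        (f1 (f2 t) (gvert G v) = (\<Sum>e\<in>out_arcs G v. f1 (f2 t) (gedge G e \<odot> gghost G e)) \<and>
        (\<forall>g\<in>gis G. f1 (f2 t) (g \<odot> gvert G v) =
          (\<Sum>e\<in>out_arcs G v. f1 (f2 t) (g \<odot> (gedge G e \<odot> gghost G e)))))"
      if v: "regular_vertex G v" for v
    proof -
      have "v \<in> verts G" using v by (simp add: regular_vertex_def)
      then show ?thesis
        unfolding gis_alg_trace_vertex_relator_iff[OF scale T v] by (simp add: f1_def)
    qed
    ultimately show ?thesis unfolding relations_def comp_def by blast
  qed
  have f12: "bij_betw (f1 \<circ> f2)
      {t \<in> {t. linear_trace scale ?C t}. \<forall>x\<in>?X. t x = 0 \<and> (\<forall>a\<in>acarrier ?C. t (amult ?C a x) = 0)}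
      {\<delta> \<in> {\<delta> \<in> {\<delta> \<in> extensional (gis G). \<forall>a\<in>gis G. \<forall>b\<in>gis G. \<delta> (a \<odot> b) = \<delta> (b \<odot> a)}.
        \<delta> (gis_zero G) = 0}. relations \<delta>}"
    by (rule bij_betw_Collect[OF bij_betw_trans[OF f2 f1]]) (use rel in simp)
  have f3: "bij_betw f3 ?L
      {t \<in> {t. linear_trace scale ?C t}. \<forall>x\<in>?X. t x = 0 \<and> (\<forall>a\<in>acarrier ?C. t (amult ?C a x) = 0)}"
    using C.bij_betw_traces_quot[OF scale leavitt_ideal_gen_carrier]
    by (simp add: f3_def leavitt_alg_def leavitt_ideal_eq)
  \<comment> \<open>All three maps are evaluations, and together they evaluate \<open>t\<close> at
    the iterated coset of \<open>single g 1\<close>, which is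
    \<open>leavitt_of_gis G g\<close>.\<close>
  have "((f1 \<circ> f2) \<circ> f3) t = restrict_to_gis G t" for t
    unfolding restrict_to_gis_def f1_def comp_def
    by (rule restrict_ext) (simp add: f2_def f3_def leavitt_of_gis_def contracted_alg_carrier)
  moreover have "{\<delta> \<in> {\<delta> \<in> {\<delta> \<in> extensional (gis G). \<forall>a\<in>gis G. \<forall>b\<in>gis G. \<delta> (a \<odot> b) = \<delta> (b \<odot> a)}.
        \<delta> (gis_zero G) = 0}. relations \<delta>} = ?D"
    unfolding relations_def gis_trace_def by blast
  ultimately show ?thesis
    using bij_betw_trans[OF f3 f12] bij_betw_cong[of ?L "(f1 \<circ> f2) \<circ> f3" "restrict_to_gis G"] by simp
qed

text \<open>Since \<open>e e*\<close> and \<open>e* e\<close> have the same value, the identity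
  without a factor \<open>g\<close> is condition (4); the identities with a factor then come from
  \<open>gis_trace_regular_vertex\<close>.\<close>

lemma gis_trace_relations_iff:
  fixes \<delta> :: "('a, 'b) gis \<Rightarrow> 'r::comm_monoid_add"
  assumes \<delta>: "gis_trace \<delta>" and v: "regular_vertex G v"
  shows "\<delta> (gvert G v) = (\<Sum>e\<in>out_arcs G v. \<delta> (gedge G e \<odot> gghost G e)) \<and>
      (\<forall>g\<in>gis G. \<delta> (g \<odot> gvert G v) = (\<Sum>e\<in>out_arcs G v. \<delta> (g \<odot> (gedge G e \<odot> gghost G e)))) \<longleftrightarrow>
    \<delta> (gvert G v) = (\<Sum>e\<in>out_arcs G v. \<delta> (gvert G (head G e)))"
proof -
  have "(\<Sum>e\<in>out_arcs G v. \<delta> (gedge G e \<odot> gghost G e)) =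
      (\<Sum>e\<in>out_arcs G v. \<delta> (gvert G (head G e)))"
    by (rule sum.cong) (use gis_trace_edge_ghost[OF \<delta>] in auto)
  then show ?thesis using gis_trace_regular_vertex[OF \<delta> v] by auto
qed

end

theorem theorem28:
  fixes E :: "('v, 'e) pre_digraph"
    and scale :: "'k::field \<Rightarrow> 'r::ring \<Rightarrow> 'r"
  assumes "wf_digraph E" and "k_algebra scale"
  shows "bij_betw (restrict_to_gis E)
    {t :: (('v, 'e) gis \<Rightarrow>\<^sub>0 'k) set set \<Rightarrow> 'r. linear_trace scale (leavitt_alg E) t}
    {\<delta> \<in> extensional (gis E).
       \<delta> (gis_zero E) = 0 \<and>
       (\<forall>x\<in>gis E. \<delta> x \<noteq> 0 \<longrightarrow>
          (\<exists>p\<in>Path E. \<exists>q\<in>ClPath E.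
             x = gis_mult E (gis_mult E (gpath E p) (gpath E q)) (gstar E p) \<or>
             x = gis_mult E (gis_mult E (gpath E p) (gstar E q)) (gstar E p))) \<and>
       (\<forall>p\<in>Path E. \<forall>q\<in>ClPath E. pran E p = psrc q \<longrightarrow>
          \<delta> (gis_mult E (gis_mult E (gpath E p) (gpath E q)) (gstar E p)) = \<delta> (gpath E q) \<and>
          \<delta> (gis_mult E (gis_mult E (gpath E p) (gstar E q)) (gstar E p)) = \<delta> (gstar E q)) \<and>
       (\<forall>p\<in>ClPath E. \<forall>q\<in>ClPath E. path_approx E p q \<longrightarrow>
          \<delta> (gpath E p) = \<delta> (gpath E q) \<and> \<delta> (gstar E p) = \<delta> (gstar E q)) \<and>
       (\<forall>v\<in>verts E. regular_vertex E v \<longrightarrow>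
          \<delta> (gvert E v) = (\<Sum>e\<in>out_arcs E v. \<delta> (gvert E (head E e))))}"
  (is "bij_betw _ _ ?R")
proof -
  interpret wf_digraph E by (rule assms(1))
  have "?R = {\<delta> \<in> extensional (gis E). path_conditions \<delta> \<and>
      (\<forall>v\<in>verts E. regular_vertex E v \<longrightarrow>
        \<delta> (gvert E v) = (\<Sum>e\<in>out_arcs E v. \<delta> (gvert E (head E e))))}"
    unfolding path_conditions_def by blast
  also have "\<dots> = {\<delta> \<in> extensional (gis E). gis_trace \<delta> \<and>
      (\<forall>v. regular_vertex E v \<longrightarrow>
        \<delta> (gvert E v) = (\<Sum>e\<in>out_arcs E v. \<delta> (gvert E (head E e))))}"
    unfolding gis_trace_iff_path_conditions regular_vertex_def by blast
  also have "\<dots> = {\<delta> \<in> extensional (gis E). gis_trace \<delta> \<and>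
      (\<forall>v. regular_vertex E v \<longrightarrow>
        \<delta> (gvert E v) = (\<Sum>e\<in>out_arcs E v. \<delta> (gis_mult E (gedge E e) (gghost E e))) \<and>
        (\<forall>g\<in>gis E. \<delta> (gis_mult E g (gvert E v)) =
          (\<Sum>e\<in>out_arcs E v. \<delta> (gis_mult E g (gis_mult E (gedge E e) (gghost E e))))))}"
    using gis_trace_relations_iff by blast
  finally show ?thesis
    using bij_betw_restrict_to_gis[OF assms(2)] by simp
qed

end
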